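(* Let $\gamma\in(0,1]$ and let $(\alpha_i)_{i\ge0}$ be a sequence of measurable functions from $\mathcal{X}$ to $\mathbb{R}$ satisfying $\sum_{j\ge0}\big\||\alpha_j|^\gamma\big\|_{2,\mathcal{X}}<\infty$. Let $(Y_k)_{k\in\mathbb{Z}}$ be the process built from $(\alpha_i)_{i\ge 0}$ in the context. Then, for any $\gamma$-Hölder function $f:\mathbb{R}\to\mathbb{R}$, the sequence $(X_k)_{k\in\mathbb{Z}}$ defined by $X_k=f(Y_k)-\mathbb{E}(f(Y_k))$ satisfies the $\mathbb{L}^2$-MMA property with $D=\sum_{k=0}^\infty P_0(X_k)$. If moreover $\sum_{j\ge0}j\,\big\||\alpha_j|^\gamma\big\|_{2,\mathcal{X}}^2<\infty$, then $(X_k)_{k\in\mathbb{Z}}$ satisfies the $\mathbb{L}^2_0$-MMA property.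
   Context: Let $(\mathcal{X},\mathcal{B},\mu)$ be a probability space and $\|\cdot\|_{2,\mathcal{X}}$ the norm of $\mathbb{L}^2(\mathcal{X},\mu)$. Let $\Omega=\mathcal{X}^{\mathbb{Z}}$ with the product $\sigma$-algebra, $\mathbb{P}=\mu^{\otimes\mathbb{Z}}$, $\pi_j(\omega)=\omega_j$, and let $T$ be the shift $(T(\omega))_i=\omega_{i+1}$. Given $(\alpha_i)_{i\ge0}$, put $A_i=\alpha_i\circ\pi_0$ and $$Y_0=\sum_{j=0}^\infty A_j\circ T^{-j}=\sum_{j=0}^\infty\alpha_j\circ\pi_{-j},\qquad Y_i=Y_0\circ T^i=\sum_{j=0}^\infty A_j\circ T^{i-j}\quad(i\in\mathbb{Z}).$$ Under $\sum_{j\ge0}\||\alpha_j|^\gamma\|_{2,\mathcal{X}}<\infty$ these are well defined (almost surely) and $|Y_0|^\gamma\in\mathbb{L}^2$. A function $f:\mathbb{R}\to\mathbb{R}$ is $\gamma$-Hölder if there is $C$ with $|f(x)-f(y)|\le C|x-y|^\gamma$ for all $x,y\in\mathbb{R}$. Let $\mathcal{F}_k=\sigma(\pi_j,\,j\le k)$, $S_n=X_1+\cdots+X_n$, $P_0(X_k)=\mathbb{E}(X_k\mid\mathcal{F}_0)-\mathbb{E}(X_k\mid\mathcal{F}_{-1})$, and $\|\cdot\|_2$ the norm of $\mathbb{L}^2(\mathbb{P})$. The $\mathbb{L}^2$-MMA property means: there exists a (necessarily unique) $\mathcal{F}_0$-measurable random variable $D\in\mathbb{L}^2$ such that $\mathbb{E}(D\circ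 T\mid\mathcal{F}_0)=0$ a.s. and $\lim_{n\to\infty}\frac1n\big\|\max_{1\le k\le n}\big|S_k-\sum_{i=1}^kD\circ T^i\big|\big\|_2^2=0$. The $\mathbb{L}^2_0$-MMA property means: there exists a (necessarily unique) $\mathcal{F}_0$-measurable random variable $D\in\mathbb{L}^2$ such that $\mathbb{E}(D\circ T\mid\mathcal{F}_0)=0$ a.s. and $\lim_{n\to\infty}\frac1n\,\mathbb{E}\big(\max_{1\le k\le n}\big(S_k-\sum_{i=1}^kD\circ T^i\big)^2\,\big|\,\mathcal{F}_0\big)=0$ almost surely and in $\mathbb{L}^1$. *)

theory Defs
  imports "HOL-Probability.Probability"
begin

text \<open>
  The \<open>L\<^sup>2\<close> norm with values in \<open>[0, \<infinity>]\<close>: it is \<open>\<infinity>\<close> when \<open>f\<^sup>2\<close> is not integrable, so that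
  finiteness of a norm, or of a series of norms, expresses membership in \<open>L\<^sup>2\<close>
  for measurable functions.
\<close>

definition L2_enorm :: "'a measure \<Rightarrow> ('a \<Rightarrow> real) \<Rightarrow> ennreal" where
  "L2_enorm M f =
     (let I = \<integral>\<^sup>+x. ennreal ((f x)\<^sup>2) \<partial>M
      in if I = \<top> then \<top> else ennreal (sqrt (enn2real I)))"

definition hoelder :: "real \<Rightarrow> (real \<Rightarrow> real) \<Rightarrow> bool" where
  "hoelder \<gamma> f \<longleftrightarrow> (\<exists>C. \<forall>x y. \<bar>f x - f y\<bar> \<le> C * \<bar>x - y\<bar> powr \<gamma>)"

definition path_space :: "'a measure \<Rightarrow> (int \<Rightarrow> 'a) measure" where
  "path_space M = PiM (UNIV :: int set) (\<lambda>_. M)"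

text \<open>\<open>shift k\<close> is the power \<open>T\<^sup>k\<close>, \<open>k \<in> \<int>\<close>, of the shift \<open>(T \<omega>)\<^sub>i = \<omega>\<^sub>i\<^sub>+\<^sub>1\<close>.\<close>

definition shift :: "int \<Rightarrow> (int \<Rightarrow> 'a) \<Rightarrow> (int \<Rightarrow> 'a)" where
  "shift k \<omega> = (\<lambda>i. \<omega> (i + k))"

text \<open>
  Only the \<open>\<sigma>\<close>-algebra \<open>\<F>\<^sub>k = \<sigma>(\<pi>\<^sub>j, j \<le> k)\<close> of \<open>past M k\<close> is meaningful, not the measure it carries;
  conditional expectations only use it as a subalgebra of \<open>path_space M\<close>.
\<close>

definition past :: "'a measure \<Rightarrow> int \<Rightarrow> (int \<Rightarrow> 'a) measure" where
  "past M k = sigma (space (path_space M))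
     (\<Union>j\<in>{..k}. {(\<lambda>\<omega>. \<omega> j) -` A \<inter> space (path_space M) | A. A \<in> sets M})"

text \<open>
  Under the hypotheses on \<open>\<alpha>\<close> under which this process is used, the series converges
  almost surely; on the remaining null set \<open>suminf\<close> takes an unspecified value.
\<close>

definition lin_proc :: "(nat \<Rightarrow> 'a \<Rightarrow> real) \<Rightarrow> int \<Rightarrow> (int \<Rightarrow> 'a) \<Rightarrow> real" where
  "lin_proc \<alpha> i \<omega> = (\<Sum>j. \<alpha> j (shift (i - int j) \<omega> 0))"

definition centred_proc ::
  "'a measure \<Rightarrow> (real \<Rightarrow> real) \<Rightarrow> (int \<Rightarrow> (int \<Rightarrow> 'a) \<Rightarrow> real) \<Rightarrow> int \<Rightarrow> (int \<Rightarrow> 'a) \<Rightarrow> real" where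
  "centred_proc M f Y k \<omega> = f (Y k \<omega>) - (\<integral>\<omega>'. f (Y k \<omega>') \<partial>path_space M)"

definition P0 :: "'a measure \<Rightarrow> ((int \<Rightarrow> 'a) \<Rightarrow> real) \<Rightarrow> (int \<Rightarrow> 'a) \<Rightarrow> real" where
  "P0 M Z \<omega> = real_cond_exp (path_space M) (past M 0) Z \<omega>
            - real_cond_exp (path_space M) (past M (-1)) Z \<omega>"

definition L2_sums ::
  "'a measure \<Rightarrow> (nat \<Rightarrow> 'a \<Rightarrow> real) \<Rightarrow> ('a \<Rightarrow> real) \<Rightarrow> bool" where
  "L2_sums M g D \<longleftrightarrow> (\<lambda>n. L2_enorm M (\<lambda>x. (\<Sum>k<n. g k x) - D x)) \<longlonglongrightarrow> 0"

definition mart_error ::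
  "(int \<Rightarrow> (int \<Rightarrow> 'a) \<Rightarrow> real) \<Rightarrow> ((int \<Rightarrow> 'a) \<Rightarrow> real) \<Rightarrow> nat \<Rightarrow> (int \<Rightarrow> 'a) \<Rightarrow> real" where
  "mart_error X D k \<omega> = (\<Sum>i=1..k. X (int i) \<omega>) - (\<Sum>i=1..k. D (shift (int i) \<omega>))"

definition mart_diff :: "'a measure \<Rightarrow> ((int \<Rightarrow> 'a) \<Rightarrow> real) \<Rightarrow> bool" where
  "mart_diff M D \<longleftrightarrow>
     D \<in> borel_measurable (past M 0) \<and>
     L2_enorm (path_space M) D < \<top> \<and>
     (AE \<omega> in path_space M.
        real_cond_exp (path_space M) (past M 0) (\<lambda>\<omega>'. D (shift 1 \<omega>')) \<omega> = 0)"

definition L2_MMA_with ::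
  "'a measure \<Rightarrow> (int \<Rightarrow> (int \<Rightarrow> 'a) \<Rightarrow> real) \<Rightarrow> ((int \<Rightarrow> 'a) \<Rightarrow> real) \<Rightarrow> bool" where
  "L2_MMA_with M X D \<longleftrightarrow>
     mart_diff M D \<and>
     (\<lambda>n. ennreal (1 / real n) *
          (L2_enorm (path_space M)
             (\<lambda>\<omega>. Max ((\<lambda>k. \<bar>mart_error X D k \<omega>\<bar>) ` {1..n})))\<^sup>2) \<longlonglongrightarrow> 0"

text \<open>
  Conditional expectations of nonnegative variables are taken in \<open>[0, \<infinity>]\<close>, and so convergence
  to \<open>0\<close> in \<open>L\<^sup>1\<close> is convergence of the integrals to \<open>0\<close>.
\<close>

definition L20_error ::
  "'a measure \<Rightarrow> (int \<Rightarrow> (int \<Rightarrow> 'a) \<Rightarrow> real) \<Rightarrow> ((int \<Rightarrow> 'a) \<Rightarrow> real) \<Rightarrow> nat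
     \<Rightarrow> (int \<Rightarrow> 'a) \<Rightarrow> ennreal" where
  "L20_error M X D n \<omega> = ennreal (1 / real n) *
     nn_cond_exp (path_space M) (past M 0)
       (\<lambda>\<omega>'. ennreal (Max ((\<lambda>k. (mart_error X D k \<omega>')\<^sup>2) ` {1..n}))) \<omega>"

definition L20_MMA :: "'a measure \<Rightarrow> (int \<Rightarrow> (int \<Rightarrow> 'a) \<Rightarrow> real) \<Rightarrow> bool" where
  "L20_MMA M X \<longleftrightarrow> (\<exists>D.
     mart_diff M D \<and>
     (AE \<omega> in path_space M. (\<lambda>n. L20_error M X D n \<omega>) \<longlonglongrightarrow> 0) \<and>
     (\<lambda>n. \<integral>\<^sup>+\<omega>. L20_error M X D n \<omega> \<partial>path_space M) \<longlonglongrightarrow> 0)"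

end

theory Submission
  imports Defs
begin

text \<open>
  Write \<open>P\<^sub>i = E(\<cdot> | \<F>\<^sub>i) - E(\<cdot> | \<F>\<^sub>i\<^sub>-\<^sub>1)\<close>. The variable \<open>X\<^sub>k\<close> sees the coordinate at time \<open>0\<close> only through the
  summand \<open>\<alpha>\<^sub>k\<close> of \<open>Y\<^sub>k\<close>. Since \<open>f\<close> is Hoelder and \<open>t\<^sup>\<gamma>\<close> is subadditive, resampling that coordinate
  moves \<open>X\<^sub>k\<close> by at most \<open>C (|\<alpha>\<^sub>k(x)|\<^sup>\<gamma> + |\<alpha>\<^sub>k(x')|\<^sup>\<gamma>)\<close>, where \<open>x\<close> is the old and \<open>x'\<close> the new value. Averaging over \<open>x'\<close> yields the
  pointwise bound \<open>|P\<^sub>0 X\<^sub>k| \<le> H\<^sub>k(\<omega>\<^sub>0)\<close> (\<open>d_bound\<close>), where \<open>H\<^sub>k = C (|\<alpha>\<^sub>k|\<^sup>\<gamma> + E|\<alpha>\<^sub>k|\<^sup>\<gamma>)\<close> has an \<open>L\<^sup>2\<close> norm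
  of at most \<open>c\<^sub>k\<close>, and the \<open>c\<^sub>k\<close> are summable. This is Hannan's condition, but with a bound that is a function of
  one coordinate: for \<open>i \<ge> 1\<close> it makes \<open>E((P\<^sub>i X\<^sub>i\<^sub>+\<^sub>k)\<^sup>2 | \<F>\<^sub>0)\<close> bounded by the constant \<open>c\<^sub>k\<^sup>2\<close>, which replaces
  every appeal to a maximal ergodic theorem.

  Conditional expectations are handled as averages over an independent copy of the future
  (\<open>splice\<close>, \<open>avg\<close>): this makes the resampling argument a statement about integrals. The same argument bounds
  \<open>E(X\<^sub>0 | \<F>\<^sub>-\<^sub>K)\<close> by the tail of a convergent series, so that almost surely
  \<open>X\<^sub>i = \<Sum>\<^sub>k \<xi>\<^sub>k\<^sub>,\<^sub>i\<^sub>-\<^sub>k\<close> and \<open>D \<circ> T\<^sup>i = \<Sum>\<^sub>k \<xi>\<^sub>k\<^sub>,\<^sub>i\<close>, absolutely convergent, with \<open>\<xi>\<^sub>k\<^sub>,\<^sub>a = (P\<^sub>0 X\<^sub>k) \<circ> T\<^sup>a\<close>.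

  Subtracting and summing over \<open>1 \<le> i \<le> n\<close>, the sum for a fixed lag \<open>k\<close> telescopes. The error splits into
  a past part, the \<open>\<xi>\<^sub>k\<^sub>,\<^sub>a\<close> with \<open>a \<le> 0\<close>, and a future part, the increments of the
  martingale \<open>\<Sum>\<^sub>i \<xi>\<^sub>k\<^sub>,\<^sub>i\<close> over the last \<open>k\<close> steps (\<open>mart_error_eq\<close>). For each \<open>k\<close> the running maximum of both parts
  is at most a constant times \<open>c\<^sub>k \<surd>N\<close> in \<open>L\<^sup>2\<close> by Doob's inequality, and it is \<open>o(\<surd>N)\<close> because only about \<open>k\<close> terms
  enter. Minkowski's inequality for series and dominated convergence in \<open>k\<close> give the first claim with \<open>D = \<Sum>\<^sub>k P\<^sub>0 X\<^sub>k\<close>.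

  For the quenched claim, the bounds on the future part are proved with an indicator \<open>1\<^sub>A\<close>, \<open>A \<in> \<F>\<^sub>0\<close>,
  under the integral and a factor \<open>P(A)\<close> on the right (\<open>nn_future\<close>): so the conditional expectation given \<open>\<F>\<^sub>0\<close> of the
  squared maximum is at most a deterministic \<open>o(n)\<close>. The past part is \<open>\<F>\<^sub>0\<close>-measurable and is the sum of
  the \<open>E(X\<^sub>i | \<F>\<^sub>0)\<close>. By orthogonality \<open>\<Sum>\<^sub>i \<parallel>E(X\<^sub>i | \<F>\<^sub>0)\<parallel>\<^sup>2 \<le> \<Sum>\<^sub>k k c\<^sub>k\<^sup>2\<close>; this is finite under the additional
  hypothesis, and a square summable sequence has partial sums \<open>o(\<surd>n)\<close>.
\<close>

section \<open>Powers with exponent at most one\<close>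

text \<open>
  For \<open>t = x / (x + y) \<in> [0, 1]\<close> one has \<open>t \<le> t\<^sup>\<gamma>\<close>; add the same inequality for \<open>1 - t\<close>.
\<close>
lemma powr_add_le:
  fixes x y \<gamma> :: real
  assumes "0 \<le> x" "0 \<le> y" "0 < \<gamma>" "\<gamma> \<le> 1"
  shows "(x + y) powr \<gamma> \<le> x powr \<gamma> + y powr \<gamma>"
proof (cases "x + y = 0")
  case False
  then have s: "0 < x + y" using assms by simp
  have *: "z / (x + y) \<le> z powr \<gamma> / (x + y) powr \<gamma>" if "0 \<le> z" "z \<le> x + y" for z
  proof -
    have "(z / (x + y)) powr 1 \<le> (z / (x + y)) powr \<gamma>"
      using that s assms by (intro powr_mono') auto
    then show ?thesis using that s by (simp add: powr_divide)
  qed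
  have "1 = x / (x + y) + y / (x + y)" using s by (simp add: add_divide_distrib[symmetric])
  also have "\<dots> \<le> x powr \<gamma> / (x + y) powr \<gamma> + y powr \<gamma> / (x + y) powr \<gamma>"
    using assms by (intro add_mono *) auto
  finally show ?thesis using s by (simp add: add_divide_distrib[symmetric] pos_le_divide_eq)
qed (use assms in auto)

lemma sum_powr_le:
  fixes a :: "nat \<Rightarrow> real"
  assumes "0 < \<gamma>" "\<gamma> \<le> 1"
  shows "\<bar>\<Sum>j<n. a j\<bar> powr \<gamma> \<le> (\<Sum>j<n. \<bar>a j\<bar> powr \<gamma>)"
proof (induction n)
  case (Suc n)
  have "\<bar>\<Sum>j<Suc n. a j\<bar> powr \<gamma> \<le> (\<bar>\<Sum>j<n. a j\<bar> + \<bar>a n\<bar>) powr \<gamma>"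
    using assms by (intro powr_mono2) auto
  also have "\<dots> \<le> \<bar>\<Sum>j<n. a j\<bar> powr \<gamma> + \<bar>a n\<bar> powr \<gamma>"
    using assms by (intro powr_add_le) auto
  finally show ?case using Suc by simp
qed auto

lemma summable_of_powr:
  fixes a :: "nat \<Rightarrow> real"
  assumes "0 < \<gamma>" "\<gamma> \<le> 1" and s: "summable (\<lambda>j. \<bar>a j\<bar> powr \<gamma>)"
  shows "summable a"
proof (rule summable_comparison_test_ev[OF _ s])
  have "(\<lambda>j. \<bar>a j\<bar> powr \<gamma>) \<longlonglongrightarrow> 0" by (rule summable_LIMSEQ_zero[OF s])
  then have "eventually (\<lambda>j. \<bar>a j\<bar> powr \<gamma> < 1) sequentially"
    by (rule order_tendstoD) simp
  then show "eventually (\<lambda>j. norm (a j) \<le> \<bar>a j\<bar> powr \<gamma>) sequentially"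
  proof eventually_elim
    case (elim j)
    have "\<bar>a j\<bar> \<le> 1"
    proof (rule ccontr)
      assume "\<not> \<bar>a j\<bar> \<le> 1"
      then have "1 \<le> \<bar>a j\<bar> powr \<gamma>" using assms by (intro ge_one_powr_ge_zero) auto
      with elim show False by simp
    qed
    then have "\<bar>a j\<bar> powr 1 \<le> \<bar>a j\<bar> powr \<gamma>" using assms by (intro powr_mono') auto
    then show ?case by simp
  qed
qed

lemma suminf_powr_le:
  fixes a :: "nat \<Rightarrow> real"
  assumes "0 < \<gamma>" "\<gamma> \<le> 1" and s: "summable (\<lambda>j. \<bar>a j\<bar> powr \<gamma>)"
  shows "\<bar>\<Sum>j. a j\<bar> powr \<gamma> \<le> (\<Sum>j. \<bar>a j\<bar> powr \<gamma>)"
proof (rule LIMSEQ_le_const2)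
  have "(\<lambda>n. \<Sum>j<n. a j) \<longlonglongrightarrow> (\<Sum>j. a j)"
    by (rule summable_LIMSEQ[OF summable_of_powr[OF assms]])
  then show "(\<lambda>n. \<bar>\<Sum>j<n. a j\<bar> powr \<gamma>) \<longlonglongrightarrow> \<bar>\<Sum>j. a j\<bar> powr \<gamma>"
    using assms by (intro tendsto_powr' tendsto_rabs tendsto_const) auto
  have "\<bar>\<Sum>j<n. a j\<bar> powr \<gamma> \<le> (\<Sum>j. \<bar>a j\<bar> powr \<gamma>)" for n
    by (rule order_trans[OF sum_powr_le[OF assms(1,2)]]) (intro sum_le_suminf s, auto)
  then show "\<exists>N. \<forall>n\<ge>N. \<bar>\<Sum>j<n. a j\<bar> powr \<gamma> \<le> (\<Sum>j. \<bar>a j\<bar> powr \<gamma>)" by blast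
qed

section \<open>Square norms and series\<close>

lemma ennreal_square_add_le: "((a::ennreal) + b)\<^sup>2 \<le> 2 * a\<^sup>2 + 2 * b\<^sup>2"
proof (cases a; cases b)
  fix x y assume [simp]: "a = ennreal x" "0 \<le> x" "b = ennreal y" "0 \<le> y"
  have "0 \<le> (x - y)\<^sup>2" by simp
  then have "(x + y)\<^sup>2 \<le> 2 * x\<^sup>2 + 2 * y\<^sup>2" by (simp add: power2_eq_square algebra_simps)
  then show ?thesis
    by (simp add: ennreal_power ennreal_mult[symmetric] ennreal_plus[symmetric]
        ennreal_numeral[symmetric] del: ennreal_plus ennreal_numeral)
qed (auto simp: ennreal_mult_top power2_eq_square)

lemma square_diff_le:
  assumes "x = y - z" "ennreal \<bar>y\<bar> \<le> p" "ennreal \<bar>z\<bar> \<le> s"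
  shows "ennreal (x\<^sup>2) \<le> 2 * p\<^sup>2 + 2 * s\<^sup>2"
proof -
  have "ennreal (x\<^sup>2) = (ennreal \<bar>x\<bar>)\<^sup>2" by (simp add: ennreal_power)
  also have "\<dots> \<le> (ennreal \<bar>y\<bar> + ennreal \<bar>z\<bar>)\<^sup>2"
    using assms(1) by (intro power_mono) (auto simp: ennreal_plus[symmetric] simp del: ennreal_plus intro!: ennreal_leI)
  also have "\<dots> \<le> (p + s)\<^sup>2" using assms by (intro power_mono add_mono) auto
  also have "\<dots> \<le> 2 * p\<^sup>2 + 2 * s\<^sup>2" by (rule ennreal_square_add_le)
  finally show ?thesis .
qed

lemma integrable_mult_of_squares:
  fixes f g :: "'a \<Rightarrow> real"
  assumes [measurable]: "f \<in> borel_measurable M" "g \<in> borel_measurable M"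
    and "integrable M (\<lambda>x. (f x)\<^sup>2)" "integrable M (\<lambda>x. (g x)\<^sup>2)"
  shows "integrable M (\<lambda>x. f x * g x)"
proof (rule Bochner_Integration.integrable_bound)
  show "integrable M (\<lambda>x. (f x)\<^sup>2 + (g x)\<^sup>2)" using assms by simp
  have "\<bar>a * b\<bar> \<le> a\<^sup>2 + b\<^sup>2" for a b :: real
  proof -
    have "0 \<le> (\<bar>a\<bar> - \<bar>b\<bar>)\<^sup>2" by simp
    then have "2 * \<bar>a * b\<bar> \<le> a\<^sup>2 + b\<^sup>2" by (simp add: power2_diff abs_mult)
    then show ?thesis using abs_ge_zero[of "a * b"] by linarith
  qed
  then show "AE x in M. norm (f x * g x) \<le> norm ((f x)\<^sup>2 + (g x)\<^sup>2)" by simp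
qed simp

lemma integrable_of_nn_integral:
  fixes g :: "'a \<Rightarrow> real"
  assumes [measurable]: "g \<in> borel_measurable M" and "(\<integral>\<^sup>+x. ennreal (g x) \<partial>M) \<le> ennreal B" "\<And>x. 0 \<le> g x"
  shows "integrable M g"
proof (rule integrableI_nonneg)
  show "(\<integral>\<^sup>+x. ennreal (g x) \<partial>M) < \<infinity>"
    using assms(2) by (simp add: order.strict_trans1)
qed (use assms in auto)

lemma (in finite_measure) integrable_of_square:
  fixes g :: "'a \<Rightarrow> real"
  assumes [measurable]: "g \<in> borel_measurable M" and "integrable M (\<lambda>x. (g x)\<^sup>2)"
  shows "integrable M g"
  using integrable_mult_of_squares[of g M "\<lambda>_. 1"] assms by simp

text \<open>
  Strictly positive weights make the right-hand side infinite as soon as one \<open>F k\<close> is, so that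
  only real numbers remain.
\<close>
lemma weighted_Cauchy_Schwarz_finite:
  fixes F :: "nat \<Rightarrow> ennreal"
  assumes c: "\<And>k. 0 < c k"
  shows "(\<Sum>k<n. F k)\<^sup>2 \<le> ennreal (\<Sum>k<n. c k) * (\<Sum>k<n. F k ^ 2 / ennreal (c k))"
proof (cases "\<exists>k<n. F k = \<top>")
  case True
  then obtain k where k: "k < n" "F k = \<top>" by auto
  then have "F k ^ 2 / ennreal (c k) = \<top>"
    using c[of k] by (simp add: ennreal_top_divide power2_eq_square)
  then have "(\<Sum>k<n. F k ^ 2 / ennreal (c k)) = \<top>"
    using member_le_sum[of k "{..<n}" "\<lambda>k. F k ^ 2 / ennreal (c k)"] k(1) by (simp add: top_unique)
  moreover have "0 < (\<Sum>k<n. c k)" using c k by (intro sum_pos) auto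
  ultimately have "ennreal (\<Sum>k<n. c k) * (\<Sum>k<n. F k ^ 2 / ennreal (c k)) = \<top>"
    by (simp only: ennreal_mult_top) simp
  then show ?thesis by simp
next
  case False
  define f where "f k = enn2real (F k)" for k
  have f: "F k = ennreal (f k)" "0 \<le> f k" if "k < n" for k
    using that False unfolding f_def by (auto simp: less_top)
  have "(\<Sum>k<n. f k)\<^sup>2 = (\<Sum>k<n. sqrt (c k) * (f k / sqrt (c k)))\<^sup>2"
    using c by (intro arg_cong[where f = "\<lambda>x. x\<^sup>2"] sum.cong) (auto simp: less_imp_neq[symmetric])
  also have "\<dots> \<le> (\<Sum>k<n. (sqrt (c k))\<^sup>2) * (\<Sum>k<n. (f k / sqrt (c k))\<^sup>2)"
    by (rule Cauchy_Schwarz_ineq_sum)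
  also have "\<dots> = (\<Sum>k<n. c k) * (\<Sum>k<n. (f k)\<^sup>2 / c k)"
    using c by (simp add: power_divide less_imp_le)
  finally have "(\<Sum>k<n. f k)\<^sup>2 \<le> (\<Sum>k<n. c k) * (\<Sum>k<n. (f k)\<^sup>2 / c k)" .
  then have "ennreal ((\<Sum>k<n. f k)\<^sup>2) \<le> ennreal ((\<Sum>k<n. c k) * (\<Sum>k<n. (f k)\<^sup>2 / c k))"
    by (rule ennreal_leI)
  also have "\<dots> = ennreal (\<Sum>k<n. c k) * (\<Sum>k<n. F k ^ 2 / ennreal (c k))"
    using c f by (subst ennreal_mult)
      (auto intro!: sum_nonneg simp: less_imp_le sum_ennreal[symmetric] divide_ennreal ennreal_power
        simp del: sum_ennreal)
  also have "ennreal ((\<Sum>k<n. f k)\<^sup>2) = (\<Sum>k<n. F k)\<^sup>2"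
  proof -
    have "(\<Sum>k<n. F k) = (\<Sum>k<n. ennreal (f k))" using f by (intro sum.cong) auto
    also have "\<dots> = ennreal (\<Sum>k<n. f k)" using f by (intro sum_ennreal) auto
    finally show ?thesis using f(2) by (simp only:) (subst ennreal_power, auto intro: sum_nonneg)
  qed
  finally show ?thesis .
qed

lemma weighted_Cauchy_Schwarz:
  fixes F :: "nat \<Rightarrow> ennreal"
  assumes c: "\<And>k. 0 < c k" and s: "summable c"
  shows "(\<Sum>k. F k)\<^sup>2 \<le> ennreal (\<Sum>k. c k) * (\<Sum>k. F k ^ 2 / ennreal (c k))"
proof -
  define B where "B = ennreal (\<Sum>k. c k) * (\<Sum>k. F k ^ 2 / ennreal (c k))"
  have *: "(\<Sum>k<n. F k)\<^sup>2 \<le> B" for n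
    unfolding B_def using c s
    by (intro order_trans[OF weighted_Cauchy_Schwarz_finite[of c]] mult_mono ennreal_leI sum_le_suminf)
      (auto simp: less_imp_le)
  have "(\<Sum>k<n. F k) * (\<Sum>k<m. F k) \<le> B" for n m
  proof -
    have "(\<Sum>k<n. F k) * (\<Sum>k<m. F k) \<le> (\<Sum>k<max n m. F k) * (\<Sum>k<max n m. F k)"
      by (intro mult_mono sum_mono2) auto
    then show ?thesis using *[of "max n m"] by (simp add: power2_eq_square)
  qed
  then have "(SUP n. \<Sum>k<n. F k) * (SUP m. \<Sum>k<m. F k) \<le> B"
    by (simp add: SUP_mult_left_ennreal SUP_mult_right_ennreal SUP_le_iff)
  then show ?thesis by (simp add: suminf_eq_SUP power2_eq_square B_def)
qed

text \<open>
  Minkowski's inequality for countably many summands, in terms of majorants of the norms. Integrating the weighted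
  Cauchy--Schwarz inequality with the majorants themselves as weights gives exactly the square of their sum. Majorants may vanish, so
  they are first enlarged by a summable sequence of total mass \<open>\<delta>\<close>, and then \<open>\<delta>\<close> tends to \<open>0\<close>.
\<close>
lemma nn_integral_suminf_square_le:
  fixes F :: "nat \<Rightarrow> 'a \<Rightarrow> ennreal"
  assumes [measurable]: "\<And>k. F k \<in> borel_measurable M"
    and c: "\<And>k. 0 \<le> c k" "summable c"
    and F: "\<And>k. (\<integral>\<^sup>+x. (F k x)\<^sup>2 \<partial>M) \<le> ennreal ((c k)\<^sup>2)"
  shows "(\<integral>\<^sup>+x. (\<Sum>k. F k x)\<^sup>2 \<partial>M) \<le> ennreal ((\<Sum>k. c k)\<^sup>2)"
proof -
  have *: "(\<integral>\<^sup>+x. (\<Sum>k. F k x)\<^sup>2 \<partial>M) \<le> ennreal (((\<Sum>k. c k) + \<delta>)\<^sup>2)" if d: "0 < \<delta>" for \<delta>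
  proof -
    define e where "e k = c k + \<delta> * (1/2) ^ Suc k" for k
    have e: "0 < e k" "c k \<le> e k" for k
      using c(1)[of k] d by (auto simp: e_def add_nonneg_pos)
    have se: "e sums ((\<Sum>k. c k) + \<delta> * 1)"
      unfolding e_def by (intro sums_add summable_sums c sums_mult power_half_series)
    then have sum: "summable e" "(\<Sum>k. e k) = (\<Sum>k. c k) + \<delta>"
      by (auto simp: sums_iff)
    have "(\<integral>\<^sup>+x. (\<Sum>k. F k x)\<^sup>2 \<partial>M) \<le> (\<integral>\<^sup>+x. ennreal (\<Sum>k. e k) * (\<Sum>k. F k x ^ 2 / ennreal (e k)) \<partial>M)"
      by (intro nn_integral_mono weighted_Cauchy_Schwarz e sum)
    also have "\<dots> = ennreal (\<Sum>k. e k) * (\<Sum>k. (\<integral>\<^sup>+x. F k x ^ 2 \<partial>M) / ennreal (e k))"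
      by (simp add: nn_integral_cmult nn_integral_suminf nn_integral_divide)
    also have "\<dots> \<le> ennreal (\<Sum>k. e k) * (\<Sum>k. ennreal (e k))"
    proof (intro mult_left_mono suminf_le)
      fix k
      have "(\<integral>\<^sup>+x. F k x ^ 2 \<partial>M) / ennreal (e k) \<le> ennreal ((e k)\<^sup>2) / ennreal (e k)"
        using F[of k] e[of k] c(1)[of k]
        by (intro divide_right_mono_ennreal) (meson ennreal_leI order_trans power_mono)
      also have "\<dots> = ennreal (e k)"
        using e[of k] by (simp add: divide_ennreal power2_eq_square)
      finally show "(\<integral>\<^sup>+x. F k x ^ 2 \<partial>M) / ennreal (e k) \<le> ennreal (e k)" .
    qed auto
    also have "\<dots> = ennreal (((\<Sum>k. c k) + \<delta>)\<^sup>2)"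
      using e sum by (simp add: suminf_ennreal2 less_imp_le suminf_nonneg ennreal_mult[symmetric]
          power2_eq_square flip: sum(2))
    finally show ?thesis .
  qed
  have "(\<lambda>n. ennreal (((\<Sum>k. c k) + 1 / real (Suc n))\<^sup>2)) \<longlonglongrightarrow> ennreal (((\<Sum>k. c k) + 0)\<^sup>2)"
    by (intro tendsto_ennrealI tendsto_power tendsto_add tendsto_const)
      (use LIMSEQ_inverse_real_of_nat in \<open>simp add: inverse_eq_divide\<close>)
  then have "(\<integral>\<^sup>+x. (\<Sum>k. F k x)\<^sup>2 \<partial>M) \<le> ennreal (((\<Sum>k. c k) + 0)\<^sup>2)"
    by (rule LIMSEQ_le_const) (intro exI[of _ 0] allI impI *, simp)
  then show ?thesis by simp
qed

lemma L2_enorm_square: "(L2_enorm M g)\<^sup>2 = (\<integral>\<^sup>+x. ennreal ((g x)\<^sup>2) \<partial>M)"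
proof (cases "(\<integral>\<^sup>+x. ennreal ((g x)\<^sup>2) \<partial>M) = \<top>")
  case False
  then have "(L2_enorm M g)\<^sup>2 = (ennreal (sqrt (enn2real (\<integral>\<^sup>+x. ennreal ((g x)\<^sup>2) \<partial>M))))\<^sup>2"
    by (simp add: L2_enorm_def)
  also have "\<dots> = (\<integral>\<^sup>+x. ennreal ((g x)\<^sup>2) \<partial>M)"
    using False by (subst ennreal_power) (auto simp: less_top)
  finally show ?thesis .
qed (simp add: L2_enorm_def power2_eq_square)

lemma L2_enorm_le:
  assumes "(\<integral>\<^sup>+x. ennreal ((g x)\<^sup>2) \<partial>M) \<le> ennreal (B\<^sup>2)" "0 \<le> B"
  shows "L2_enorm M g \<le> ennreal B"
proof -
  have "(\<integral>\<^sup>+x. ennreal ((g x)\<^sup>2) \<partial>M) \<noteq> \<top>" using assms(1) by (auto simp: top_unique)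
  moreover have "sqrt (enn2real (\<integral>\<^sup>+x. ennreal ((g x)\<^sup>2) \<partial>M)) \<le> B"
    using assms by (intro real_le_lsqrt) (auto intro: enn2real_leI)
  ultimately show ?thesis by (simp add: L2_enorm_def ennreal_leI)
qed

lemma L2_enorm_cong_AE:
  assumes "AE x in N. g x = g' x"
  shows "L2_enorm N g = L2_enorm N g'"
proof -
  have "(\<integral>\<^sup>+x. ennreal ((g x)\<^sup>2) \<partial>N) = (\<integral>\<^sup>+x. ennreal ((g' x)\<^sup>2) \<partial>N)"
    using assms by (intro nn_integral_cong_AE) auto
  then show ?thesis by (simp add: L2_enorm_def)
qed

text \<open>
  If the right-hand side is finite, it forces absolute convergence of the left-hand series.
\<close>
lemma ennreal_abs_suminf_le:
  fixes g B :: "nat \<Rightarrow> real"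
  assumes g: "\<And>k. \<bar>g k\<bar> \<le> B k"
  shows "ennreal \<bar>\<Sum>k. g k\<bar> \<le> (\<Sum>k. ennreal (B k))"
proof (cases "(\<Sum>k. ennreal (B k)) = \<top>")
  case False
  have B: "0 \<le> B k" for k using g[of k] by linarith
  have sB: "summable B" using B False by (intro summable_suminf_not_top) auto
  then have sg: "summable (\<lambda>k. \<bar>g k\<bar>)"
    by (rule summable_comparison_test') (use g in auto)
  have "\<bar>\<Sum>k. g k\<bar> \<le> (\<Sum>k. \<bar>g k\<bar>)" by (rule summable_rabs[OF sg])
  also have "\<dots> \<le> (\<Sum>k. B k)" using g by (intro suminf_le sg sB) auto
  finally show ?thesis using sB B by (simp add: suminf_ennreal2 ennreal_leI)
qed simp

lemma numeral_mult_ennreal: "0 \<le> x \<Longrightarrow> numeral w * ennreal x = ennreal (numeral w * x)"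
  by (simp add: ennreal_mult)

text \<open>
  A delay by \<open>k\<close> only shortens the range: this makes the sums for a fixed lag telescope. For \<open>n < k\<close> the natural
  subtraction on the right gives the empty sum.
\<close>
lemma sum_delayed:
  fixes g :: "nat \<Rightarrow> real"
  shows "(\<Sum>i<n. if k \<le> i then g (i - k) else 0) = (\<Sum>i<n - k. g i)"
  by (induction n) (auto simp: Suc_diff_le not_le)

lemma sum_before:
  fixes g :: "nat \<Rightarrow> real"
  shows "(\<Sum>i<n. if i < k then g i else 0) = (\<Sum>i<min n k. g i)"
  by (induction n) (auto simp: min_def not_le less_Suc_eq)

lemma suminf_swap_ennreal:
  fixes g :: "nat \<Rightarrow> nat \<Rightarrow> ennreal"
  shows "(\<Sum>i. \<Sum>k. g i k) = (\<Sum>k. \<Sum>i. g i k)"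
  using nn_integral_suminf[of g "count_space UNIV"] by (simp add: nn_integral_count_space_nat)

text \<open>
  Cauchy--Schwarz on the block after \<open>m\<close> bounds its square divided by \<open>n\<close> by the tail \<open>\<Sum>\<^sub>i\<^sub>\<ge>\<^sub>m (z i)\<^sup>2\<close>; the first \<open>m\<close> terms
  contribute \<open>O(1/n)\<close>.
\<close>
lemma square_sum_over_n_tendsto_0:
  fixes z :: "nat \<Rightarrow> real"
  assumes s: "summable (\<lambda>i. (z i)\<^sup>2)"
  shows "(\<lambda>n. (\<Sum>i<n. \<bar>z i\<bar>)\<^sup>2 / real n) \<longlonglongrightarrow> 0"
proof (rule LIMSEQ_I)
  fix e :: real assume e: "0 < e"
  obtain m where "norm (\<Sum>i. (z (i + m))\<^sup>2) < e / 4"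
    using suminf_exist_split[OF _ s, of "e/4"] e by auto
  then have m: "(\<Sum>i. (z (i + m))\<^sup>2) < e / 4" by simp
  define B where "B = (\<Sum>i<m. \<bar>z i\<bar>)\<^sup>2"
  have bound: "(\<Sum>i<n. \<bar>z i\<bar>)\<^sup>2 \<le> 2 * B + real n * (e / 2)" if "m \<le> n" for n
  proof -
    have "(\<Sum>i<n. \<bar>z i\<bar>) = (\<Sum>i<m. \<bar>z i\<bar>) + (\<Sum>i=m..<n. \<bar>z i\<bar>)"
      using sum.atLeastLessThan_concat[of 0 m n "\<lambda>i. \<bar>z i\<bar>"] that by (simp add: atLeast0LessThan)
    moreover have "(a + b)\<^sup>2 \<le> 2 * a\<^sup>2 + 2 * b\<^sup>2" for a b :: real
      using zero_le_power2[of "a - b"] by (simp add: power2_eq_square algebra_simps)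
    ultimately have "(\<Sum>i<n. \<bar>z i\<bar>)\<^sup>2 \<le> 2 * B + 2 * (\<Sum>i=m..<n. \<bar>z i\<bar>)\<^sup>2"
      unfolding B_def by metis
    also have "(\<Sum>i=m..<n. \<bar>z i\<bar>)\<^sup>2 = (\<Sum>i=m..<n. 1 * \<bar>z i\<bar>)\<^sup>2" by simp
    also have "\<dots> \<le> (\<Sum>i=m..<n. 1\<^sup>2) * (\<Sum>i=m..<n. \<bar>z i\<bar>\<^sup>2)" by (rule Cauchy_Schwarz_ineq_sum)
    also have "\<dots> \<le> real n * (e / 4)"
    proof (intro mult_mono)
      have "(\<Sum>i=m..<n. \<bar>z i\<bar>\<^sup>2) = (\<Sum>i<n - m. (z (i + m))\<^sup>2)"
        using that sum.shift_bounds_nat_ivl[of "\<lambda>i. \<bar>z i\<bar>\<^sup>2" 0 m "n - m"] by (simp add: atLeast0LessThan)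
      also have "\<dots> \<le> (\<Sum>i. (z (i + m))\<^sup>2)"
        using s by (intro sum_le_suminf) (auto intro: summable_ignore_initial_segment[of "\<lambda>i. (z i)\<^sup>2"])
      finally show "(\<Sum>i=m..<n. \<bar>z i\<bar>\<^sup>2) \<le> e / 4" using m by simp
    qed (auto simp: sum_nonneg)
    finally show ?thesis by (simp add: mult.commute)
  qed
  obtain n0 :: nat where n0: "4 * B / e < real n0" using reals_Archimedean2 by blast
  show "\<exists>N. \<forall>n\<ge>N. norm ((\<Sum>i<n. \<bar>z i\<bar>)\<^sup>2 / real n - 0) < e"
  proof (intro exI[of _ "max m (Suc n0)"] allI impI)
    fix n assume n: "max m (Suc n0) \<le> n"
    then have "4 * B / e < real n" "0 < real n" using n0 by auto
    then have "2 * B + real n * (e / 2) < e * real n" using e by (simp add: field_simps)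
    then have "(\<Sum>i<n. \<bar>z i\<bar>)\<^sup>2 < e * real n" using bound[of n] n by simp
    then show "norm ((\<Sum>i<n. \<bar>z i\<bar>)\<^sup>2 / real n - 0) < e"
      using \<open>0 < real n\<close> by (simp add: pos_divide_less_eq)
  qed
qed

section \<open>Doob's maximal inequality\<close>

definition running_max :: "(nat \<Rightarrow> real) \<Rightarrow> nat \<Rightarrow> real" where
  "running_max s n = Max ((\<lambda>m. \<bar>s m\<bar>) ` {..n})"

lemma running_max_0[simp]: "running_max s 0 = \<bar>s 0\<bar>"
  by (simp add: running_max_def)

lemma running_max_Suc[simp]: "running_max s (Suc n) = max (running_max s n) \<bar>s (Suc n)\<bar>"
  by (simp add: running_max_def atMost_Suc max.commute)

lemma abs_le_running_max: "m \<le> n \<Longrightarrow> \<bar>s m\<bar> \<le> running_max s n"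
  unfolding running_max_def by (rule Max_ge) auto

lemma running_max_le: "(\<And>m. m \<le> n \<Longrightarrow> \<bar>s m\<bar> \<le> b) \<Longrightarrow> running_max s n \<le> b"
  unfolding running_max_def by (subst Max_le_iff) auto

lemma running_max_nonneg[simp]: "0 \<le> running_max s n"
  using abs_le_running_max[of 0 n s] by linarith

lemma running_max_measurable:
  assumes "\<And>m. m \<le> n \<Longrightarrow> (\<lambda>x. s x m) \<in> borel_measurable M"
  shows "(\<lambda>x. running_max (s x) n) \<in> borel_measurable M"
  using assms by (induction n) auto

text \<open>
  The pathwise form of Doob's \<open>L\<^sup>2\<close> inequality: for a martingale, the sum on the right is a martingale transform and
  has expectation zero. Summation by parts of \<open>\<Sum>\<^sub>i S\<^sub>i (|s\<^sub>i\<^sub>+\<^sub>1| - |s\<^sub>i|)\<close>, where \<open>S\<close> is the running maximum, uses that \<open>S\<close>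
  increases only when \<open>S\<^sub>i\<^sub>+\<^sub>1 = |s\<^sub>i\<^sub>+\<^sub>1|\<close>. The signs then turn \<open>|s\<^sub>i\<^sub>+\<^sub>1| - |s\<^sub>i|\<close> into the increments of \<open>s\<close> itself.
\<close>
lemma running_max_square_le:
  assumes "s 0 = 0"
  shows "(running_max s n)\<^sup>2 \<le>
     4 * (s n)\<^sup>2 - 4 * (\<Sum>i<n. running_max s i * sgn (s i) * (s (Suc i) - s i))"
proof -
  let ?S = "running_max s"
  have "(?S n)\<^sup>2 / 2 \<le> ?S n * \<bar>s n\<bar> - (\<Sum>i<n. ?S i * (\<bar>s (Suc i)\<bar> - \<bar>s i\<bar>))"
  proof (induction n)
    case (Suc n)
    have "?S n * ?S n / 2 \<le> ?S (Suc n) * \<bar>s (Suc n)\<bar> - ?S n * \<bar>s (Suc n)\<bar> + (?S n)\<^sup>2 - ?S (Suc n) * ?S (Suc n) / 2"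
    proof (cases "\<bar>s (Suc n)\<bar> \<le> ?S n")
      case False
      have "0 \<le> (\<bar>s (Suc n)\<bar> - ?S n)\<^sup>2" by simp
      then show ?thesis using False
        by (simp add: max_def power2_eq_square algebra_simps)
    qed (simp add: max_def power2_eq_square)
    then show ?case using Suc by (simp add: algebra_simps power2_eq_square)
  qed (simp add: assms)
  moreover have "(\<Sum>i<n. ?S i * sgn (s i) * (s (Suc i) - s i)) \<le> (\<Sum>i<n. ?S i * (\<bar>s (Suc i)\<bar> - \<bar>s i\<bar>))"
  proof (rule sum_mono)
    fix i
    have "sgn (s i) * (s (Suc i) - s i) \<le> \<bar>s (Suc i)\<bar> - \<bar>s i\<bar>"
      by (auto simp: sgn_if)
    then show "?S i * sgn (s i) * (s (Suc i) - s i) \<le> ?S i * (\<bar>s (Suc i)\<bar> - \<bar>s i\<bar>)"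
      by (simp add: mult.assoc mult_left_mono)
  qed
  moreover have "2 * (?S n * \<bar>s n\<bar>) \<le> (?S n)\<^sup>2 / 2 + 2 * (s n)\<^sup>2"
  proof -
    have "0 \<le> (?S n - 2 * \<bar>s n\<bar>)\<^sup>2" by simp
    also have "\<dots> = (?S n)\<^sup>2 + 4 * (s n)\<^sup>2 - 4 * (?S n * \<bar>s n\<bar>)"
      by (simp add: power2_diff power_mult_distrib)
    finally show ?thesis by simp
  qed
  ultimately show ?thesis by (simp add: field_simps)
qed

text \<open>
  The martingale property enters only as orthogonality of each increment to the square integrable functions of the past.
  The event \<open>A\<close> belongs to the initial \<open>\<sigma>\<close>-algebra, so its indicator can be absorbed in the test functions; for varying \<open>A\<close>
  this is the maximal inequality conditional on that \<open>\<sigma>\<close>-algebra.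
\<close>
lemma Doob_L2:
  fixes d :: "nat \<Rightarrow> 'a \<Rightarrow> real" and F :: "nat \<Rightarrow> 'a measure"
  defines "s \<equiv> \<lambda>n x. \<Sum>i<n. d i x"
  assumes sub: "\<And>i. subalgebra M (F i)"
    and mono: "\<And>i. subalgebra (F (Suc i)) (F i)"
    and adapted: "\<And>i. d i \<in> borel_measurable (F (Suc i))"
    and sq: "\<And>i. integrable M (\<lambda>x. (d i x)\<^sup>2)"
    and orth: "\<And>i G. G \<in> borel_measurable (F i) \<Longrightarrow> integrable M (\<lambda>x. (G x)\<^sup>2) \<Longrightarrow>
        (\<integral>x. G x * d i x \<partial>M) = 0"
    and A: "A \<in> sets (F 0)"
    and p: "0 \<le> p" "\<And>i. (\<integral>\<^sup>+x. indicator A x * ennreal ((d i x)\<^sup>2) \<partial>M) \<le> ennreal p"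
  shows "(\<integral>\<^sup>+x. indicator A x * ennreal ((running_max (\<lambda>n. s n x) N)\<^sup>2) \<partial>M) \<le> ennreal (4 * real N * p)"
proof -
  have mono': "g \<in> borel_measurable (F j)" if "i \<le> j" "g \<in> borel_measurable (F i)" for g :: "'a \<Rightarrow> real" and i j
    using that by (induction rule: dec_induct) (auto intro: measurable_from_subalg[OF mono])
  have dF: "d i \<in> borel_measurable (F j)" if "i < j" for i j
    using mono'[OF _ adapted[of i]] that by simp
  have fromF: "g \<in> borel_measurable M" if "g \<in> borel_measurable (F i)" for g :: "'a \<Rightarrow> real" and i
    using that measurable_from_subalg[OF sub] by blast
  have [measurable]: "d i \<in> borel_measurable M" for i using fromF[OF adapted] .
  have AF: "A \<in> sets (F i)" for i
    by (induction i) (use A mono in \<open>auto simp: subalgebra_def\<close>)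
  then have [measurable]: "A \<in> sets M" using sub by (auto simp: subalgebra_def)
  define I where "I x = (indicator A x :: real)" for x
  have IF: "I \<in> borel_measurable (F i)" for i
    unfolding I_def using AF by auto
  have [measurable]: "I \<in> borel_measurable M" using fromF[OF IF] .
  have I01: "0 \<le> I x" "I x \<le> 1" "I x * I x = I x" for x by (auto simp: I_def indicator_def)
  have sF: "s n \<in> borel_measurable (F i)" if "n \<le> i" for n i
    unfolding s_def using that by (intro borel_measurable_sum dF) auto
  have [measurable]: "s n \<in> borel_measurable M" for n using fromF[OF sF] by blast
  define S where "S n x = running_max (\<lambda>n. s n x) n" for n x
  have SF: "S n \<in> borel_measurable (F i)" if "n \<le> i" for n i
    unfolding S_def using that by (intro running_max_measurable sF) auto
  have [measurable]: "S n \<in> borel_measurable M" for n using fromF[OF SF] by blast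
  \<comment> \<open>A crude bound, only to make the test functions built from \<open>S\<close> square integrable.\<close>
  have S_le: "S n x \<le> (\<Sum>i<n. \<bar>d i x\<bar>)" for n x
    unfolding S_def s_def
  proof (rule running_max_le)
    fix m assume "m \<le> n"
    have "\<bar>\<Sum>i<m. d i x\<bar> \<le> (\<Sum>i<m. \<bar>d i x\<bar>)" by (rule sum_abs)
    also have "\<dots> \<le> (\<Sum>i<n. \<bar>d i x\<bar>)" using \<open>m \<le> n\<close> by (intro sum_mono2) auto
    finally show "\<bar>\<Sum>i<m. d i x\<bar> \<le> (\<Sum>i<n. \<bar>d i x\<bar>)" .
  qed
  have S_sq: "(S n x)\<^sup>2 \<le> real n * (\<Sum>i<n. (d i x)\<^sup>2)" for n x
  proof -
    have "(S n x)\<^sup>2 \<le> (\<Sum>i<n. 1 * \<bar>d i x\<bar>)\<^sup>2" using S_le[of n x] by (intro power_mono) (auto simp: S_def)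
    also have "\<dots> \<le> (\<Sum>i<n. 1\<^sup>2) * (\<Sum>i<n. \<bar>d i x\<bar>\<^sup>2)" by (rule Cauchy_Schwarz_ineq_sum)
    finally show ?thesis by simp
  qed
  have dom: "integrable M (\<lambda>x. (G x)\<^sup>2)"
    if "G \<in> borel_measurable M" "\<And>x. \<bar>G x\<bar> \<le> S n x" for G n
  proof (rule Bochner_Integration.integrable_bound)
    show "integrable M (\<lambda>x. real n * (\<Sum>i<n. (d i x)\<^sup>2))" using sq by auto
    have "(G x)\<^sup>2 \<le> real n * (\<Sum>i<n. (d i x)\<^sup>2)" for x
      using power_mono[OF that(2)[of x], of 2] S_sq[of n x] by simp
    then show "AE x in M. norm ((G x)\<^sup>2) \<le> norm (real n * (\<Sum>i<n. (d i x)\<^sup>2))"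
      by (auto simp: sum_nonneg)
  qed (use that in simp)
  have s_le: "\<bar>s n x\<bar> \<le> S n x" for n x unfolding S_def by (rule abs_le_running_max) simp
  have S0: "0 \<le> S n x" for n x by (simp add: S_def)
  have Is: "\<bar>I x * s n x\<bar> \<le> S n x" for n x
    using s_le[of n x] S0[of n x] by (auto simp: I_def indicator_def)
  have ISs: "\<bar>I x * (S n x * sgn (s n x))\<bar> \<le> S n x" for n x
    using S0[of n x] by (auto simp: I_def indicator_def abs_mult sgn_if)
  have int_sd: "integrable M (\<lambda>x. (I x * s n x) * d n x)" for n
    by (intro integrable_mult_of_squares sq dom[OF _ Is]) auto
  have int_Sd: "integrable M (\<lambda>x. (I x * (S n x * sgn (s n x))) * d n x)" for n
    by (intro integrable_mult_of_squares sq dom[OF _ ISs]) auto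
  have orth1: "(\<integral>x. (I x * s n x) * d n x \<partial>M) = 0" for n
    by (intro orth dom[OF _ Is] borel_measurable_times IF sF) auto
  have orth2: "(\<integral>x. (I x * (S n x * sgn (s n x))) * d n x \<partial>M) = 0" for n
  proof (intro orth dom[OF _ ISs])
    note [measurable] = IF[of n] SF[of n n, simplified] sF[of n n, simplified]
    show "(\<lambda>x. I x * (S n x * sgn (s n x))) \<in> borel_measurable (F n)" by measurable
  qed measurable
  have int_d: "integrable M (\<lambda>x. I x * (d n x)\<^sup>2)" for n
    unfolding I_def using integrable_mult_indicator[OF \<open>A \<in> sets M\<close> sq[of n]] by simp
  have int_s: "integrable M (\<lambda>x. I x * (s n x)\<^sup>2)" for n
    unfolding I_def using integrable_mult_indicator[OF \<open>A \<in> sets M\<close> dom[OF _ s_le[of n]]] by simp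
  have int_S: "integrable M (\<lambda>x. I x * (S n x)\<^sup>2)" for n
    unfolding I_def using integrable_mult_indicator[OF \<open>A \<in> sets M\<close> dom[of "S n" n]] S0 by simp
  have d_le: "(\<integral>x. I x * (d n x)\<^sup>2 \<partial>M) \<le> p" for n
  proof -
    have "ennreal (\<integral>x. I x * (d n x)\<^sup>2 \<partial>M) = (\<integral>\<^sup>+x. ennreal (I x * (d n x)\<^sup>2) \<partial>M)"
      using int_d I01 by (intro nn_integral_eq_integral[symmetric]) auto
    also have "\<dots> = (\<integral>\<^sup>+x. indicator A x * ennreal ((d n x)\<^sup>2) \<partial>M)"
      by (intro nn_integral_cong) (auto simp: I_def indicator_def)
    also have "\<dots> \<le> ennreal p" by (rule p)
    finally show ?thesis using p(1) by simp
  qed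
  have s2: "(\<integral>x. I x * (s n x)\<^sup>2 \<partial>M) \<le> real n * p" for n
  proof (induction n)
    case (Suc n)
    have "(\<lambda>x. I x * (s (Suc n) x)\<^sup>2) = (\<lambda>x. I x * (s n x)\<^sup>2 + 2 * ((I x * s n x) * d n x) + I x * (d n x)\<^sup>2)"
      by (simp add: s_def power2_eq_square algebra_simps)
    then have "(\<integral>x. I x * (s (Suc n) x)\<^sup>2 \<partial>M) = (\<integral>x. I x * (s n x)\<^sup>2 \<partial>M) + (\<integral>x. I x * (d n x)\<^sup>2 \<partial>M)"
      using int_s[of n] int_sd[of n] int_d[of n] by (simp add: orth1)
    then show ?case using Suc d_le[of n] by (simp add: algebra_simps)
  qed (simp add: s_def)
  have "(\<integral>x. I x * (S N x)\<^sup>2 \<partial>M) \<le>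
     (\<integral>x. 4 * (I x * (s N x)\<^sup>2) - 4 * (\<Sum>i<N. (I x * (S i x * sgn (s i x))) * d i x) \<partial>M)"
  proof (rule integral_mono[OF int_S])
    show "integrable M (\<lambda>x. 4 * (I x * (s N x)\<^sup>2) - 4 * (\<Sum>i<N. (I x * (S i x * sgn (s i x))) * d i x))"
      using int_s int_Sd by auto
    fix x
    have "(S N x)\<^sup>2 \<le> 4 * (s N x)\<^sup>2 - 4 * (\<Sum>i<N. S i x * sgn (s i x) * (s (Suc i) x - s i x))"
      unfolding S_def by (rule running_max_square_le) (simp add: s_def)
    also have "\<dots> = 4 * (s N x)\<^sup>2 - 4 * (\<Sum>i<N. S i x * sgn (s i x) * d i x)"
      by (simp add: s_def)
    finally have "I x * (S N x)\<^sup>2 \<le> I x * (4 * (s N x)\<^sup>2 - 4 * (\<Sum>i<N. S i x * sgn (s i x) * d i x))"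
      using I01 by (intro mult_left_mono) auto
    then show "I x * (S N x)\<^sup>2 \<le> 4 * (I x * (s N x)\<^sup>2) - 4 * (\<Sum>i<N. (I x * (S i x * sgn (s i x))) * d i x)"
      by (simp add: algebra_simps sum_distrib_left)
  qed
  also have "\<dots> = 4 * (\<integral>x. I x * (s N x)\<^sup>2 \<partial>M)"
    using int_s int_Sd by (simp add: orth2)
  also have "\<dots> \<le> 4 * real N * p" using s2[of N] by simp
  finally have *: "(\<integral>x. I x * (S N x)\<^sup>2 \<partial>M) \<le> 4 * real N * p" .
  have "(\<integral>\<^sup>+x. indicator A x * ennreal ((S N x)\<^sup>2) \<partial>M) = (\<integral>\<^sup>+x. ennreal (I x * (S N x)\<^sup>2) \<partial>M)"
    by (intro nn_integral_cong) (auto simp: I_def indicator_def)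
  also have "\<dots> = ennreal (\<integral>x. I x * (S N x)\<^sup>2 \<partial>M)"
    using int_S I01 by (intro nn_integral_eq_integral) auto
  finally show ?thesis using * by (simp add: S_def ennreal_leI)
qed

section \<open>A criterion for bounded conditional expectations\<close>

text \<open>
  Otherwise the \<open>F\<close>-measurable event where the conditional expectation exceeds \<open>\<kappa>\<close> by \<open>1 / (j + 1)\<close> has positive
  measure for some \<open>j\<close>, and violates the hypothesis.
\<close>
lemma (in finite_measure_subalgebra) nn_cond_exp_le_const:
  assumes [measurable]: "g \<in> borel_measurable M" and \<kappa>: "0 \<le> \<kappa>"
    and g: "\<And>A. A \<in> sets F \<Longrightarrow> (\<integral>\<^sup>+x. indicator A x * g x \<partial>M) \<le> ennreal \<kappa> * emeasure M A"
  shows "AE x in M. nn_cond_exp M F g x \<le> ennreal \<kappa>"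
proof -
  let ?E = "nn_cond_exp M F g"
  define B where "B j = {x \<in> space F. ennreal (\<kappa> + 1 / real (Suc j)) \<le> ?E x}" for j
  have BF: "B j \<in> sets F" for j
    unfolding B_def by measurable
  then have [measurable]: "B j \<in> sets M" for j using subalg by (auto simp: subalgebra_def)
  have "AE x in M. x \<notin> B j" for j
  proof -
    have "ennreal (\<kappa> + 1 / real (Suc j)) * emeasure M (B j) = (\<integral>\<^sup>+x. ennreal (\<kappa> + 1 / real (Suc j)) * indicator (B j) x \<partial>M)"
      by (simp add: nn_integral_cmult)
    also have "\<dots> \<le> (\<integral>\<^sup>+x. indicator (B j) x * ?E x \<partial>M)"
      by (intro nn_integral_mono) (auto simp: B_def indicator_def)
    also have "\<dots> = (\<integral>\<^sup>+x. indicator (B j) x * g x \<partial>M)"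
      using BF by (intro nn_cond_exp_intg) auto
    also have "\<dots> \<le> ennreal \<kappa> * emeasure M (B j)" by (rule g[OF BF])
    finally have "ennreal ((\<kappa> + 1 / real (Suc j)) * measure M (B j)) \<le> ennreal (\<kappa> * measure M (B j))"
      using \<kappa> by (subst (1 2) ennreal_mult) (auto simp: emeasure_eq_measure)
    then have "(\<kappa> + 1 / real (Suc j)) * measure M (B j) \<le> \<kappa> * measure M (B j)"
      using \<kappa> by (subst (asm) ennreal_le_iff) auto
    then have "measure M (B j) / real (Suc j) \<le> 0" by (simp add: algebra_simps)
    then have "measure M (B j) = 0"
      using measure_nonneg[of M "B j"] by (simp add: divide_le_0_iff)
    then show ?thesis
      by (intro AE_not_in null_setsI) (auto simp: emeasure_eq_measure)
  qed
  then have "AE x in M. \<forall>j. x \<notin> B j" by (simp add: AE_all_countable)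
  with AE_space show ?thesis
  proof eventually_elim
    case (elim x)
    then have less: "?E x < ennreal (\<kappa> + 1 / real (Suc j))" for j
      using subalg by (auto simp: B_def subalgebra_def not_le)
    show ?case
    proof (rule ennreal_le_epsilon)
      fix e :: real assume "0 < e"
      then obtain j where "inverse (real (Suc j)) < e" using reals_Archimedean by blast
      then have "ennreal (\<kappa> + 1 / real (Suc j)) \<le> ennreal (\<kappa> + e)"
        by (intro ennreal_leI) (simp add: inverse_eq_divide)
      with less[of j] have "?E x \<le> ennreal (\<kappa> + e)" by (meson less_imp_le order_trans)
      then show "?E x \<le> ennreal \<kappa> + ennreal e" using \<kappa> \<open>0 < e\<close> by (simp add: ennreal_plus)
    qed
  qed
qed

section \<open>The path space\<close>

text \<open>
  With \<open>\<omega>'\<close> an independent copy of \<open>\<omega>\<close>, this resamples the coordinates after time \<open>k\<close> and keeps those that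
  generate \<open>\<F>\<^sub>k\<close>.
\<close>
definition splice :: "int \<Rightarrow> (int \<Rightarrow> 'a) \<Rightarrow> (int \<Rightarrow> 'a) \<Rightarrow> (int \<Rightarrow> 'a)" where
  "splice k \<omega> \<omega>' = (\<lambda>i. if i \<le> k then \<omega> i else \<omega>' i)"

locale iid_path = prob_space M for M :: "'a measure"
begin

abbreviation "P \<equiv> path_space M"

sublocale path: prob_space P
  unfolding path_space_def by (intro prob_space_PiM prob_space_axioms)

sublocale pair: pair_prob_space P P ..

lemma space_path: "\<omega> \<in> space P \<longleftrightarrow> (\<forall>i. \<omega> i \<in> space M)"
  by (auto simp: path_space_def space_PiM PiE_iff)

lemma measurable_path_iff:
  "g \<in> measurable N P \<longleftrightarrow> (\<forall>i. (\<lambda>x. g x i) \<in> measurable N M)"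
proof
  assume g: "g \<in> measurable N P"
  show "\<forall>i. (\<lambda>x. g x i) \<in> measurable N M"
    using measurable_compose[OF g[unfolded path_space_def] measurable_component_singleton] by auto
next
  assume *: "\<forall>i. (\<lambda>x. g x i) \<in> measurable N M"
  have "g x i \<in> space M" if "x \<in> space N" for x i
    using measurable_space[OF *[rule_format]] that .
  with * show "g \<in> measurable N P"
    unfolding path_space_def by (intro measurable_PiM_single') (auto simp: PiE_iff)
qed

lemma coord_measurable[measurable]: "(\<lambda>\<omega>. \<omega> i) \<in> measurable P M"
  using measurable_path_iff[of "\<lambda>\<omega>. \<omega>" P] measurable_ident[of P] by (auto simp: id_def)

lemma shift_measurable[measurable]: "shift a \<in> measurable P P"
  by (auto simp: measurable_path_iff shift_def)

lemma splice_measurable[measurable]: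
  "(\<lambda>z. splice k (fst z) (snd z)) \<in> measurable (P \<Otimes>\<^sub>M P) P"
  unfolding measurable_path_iff splice_def
proof
  fix i show "(\<lambda>z. if i \<le> k then fst z i else snd z i) \<in> measurable (P \<Otimes>\<^sub>M P) M"
    by (cases "i \<le> k") (auto intro!: measurable_compose[OF measurable_fst coord_measurable]
        measurable_compose[OF measurable_snd coord_measurable])
qed

lemma splice_measurable2[measurable]:
  "\<omega> \<in> space P \<Longrightarrow> splice k \<omega> \<in> measurable P P"
  unfolding measurable_path_iff splice_def
proof
  fix i assume "\<omega> \<in> space P" then show "(\<lambda>x. if i \<le> k then \<omega> i else x i) \<in> measurable P M"
    by (cases "i \<le> k") (auto simp: space_path)
qed

lemma path_cylinder:
  assumes "finite J" "\<And>i. i \<in> J \<Longrightarrow> F i \<in> sets M"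
  shows "emeasure P {\<omega>\<in>space P. \<forall>i\<in>J. \<omega> i \<in> F i} = (\<Prod>i\<in>J. emeasure M (F i))"
proof -
  have "{\<omega>\<in>space P. \<forall>i\<in>J. \<omega> i \<in> F i} = prod_emb UNIV (\<lambda>_. M) J (PiE J F)"
    by (auto simp: prod_emb_def path_space_def space_PiM PiE_iff)
  then show ?thesis unfolding path_space_def
    by (simp only:) (rule emeasure_PiM_emb, auto simp: prob_space_axioms assms)
qed

lemma path_eqI:
  assumes "sets N = sets P"
    and "\<And>J F. finite J \<Longrightarrow> (\<And>i. i \<in> J \<Longrightarrow> F i \<in> sets M) \<Longrightarrow>
      emeasure N {\<omega>\<in>space P. \<forall>i\<in>J. \<omega> i \<in> F i} = (\<Prod>i\<in>J. emeasure M (F i))"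
  shows "N = P"
proof -
  interpret Q: product_prob_space "\<lambda>_. M" "UNIV :: int set"
    by unfold_locales
  show ?thesis
    unfolding path_space_def
  proof (rule Q.PiM_eq)
    fix J :: "int set" and F assume J: "finite J" "\<And>j. j \<in> J \<Longrightarrow> F j \<in> sets M"
    have "{\<omega>\<in>space P. \<forall>i\<in>J. \<omega> i \<in> F i} = prod_emb UNIV (\<lambda>_. M) J (PiE J F)"
      by (auto simp: prod_emb_def path_space_def space_PiM PiE_iff)
    with assms(2)[of J F] J show "emeasure N (prod_emb UNIV (\<lambda>_. M) J (PiE J F)) = (\<Prod>i\<in>J. emeasure M (F i))"
      by simp
  qed (use assms in \<open>simp add: path_space_def\<close>)
qed

lemma distr_shift: "distr P P (shift a) = P"
proof (rule path_eqI)
  fix J :: "int set" and F :: "int \<Rightarrow> 'a set" assume J: "finite J" "\<And>i. i \<in> J \<Longrightarrow> F i \<in> sets M"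
  have "(\<forall>i\<in>J. \<omega> (i + a) \<in> F i) \<longleftrightarrow> (\<forall>i\<in>(\<lambda>i. i + a) ` J. \<omega> i \<in> F (i - a))" for \<omega>
    by auto
  then have "shift a -` {\<omega> \<in> space P. \<forall>i\<in>J. \<omega> i \<in> F i} \<inter> space P
      = {\<omega>\<in>space P. \<forall>i\<in>(\<lambda>i. i + a) ` J. \<omega> i \<in> F (i - a)}"
    by (auto simp: shift_def space_path)
  moreover have "{\<omega> \<in> space P. \<forall>i\<in>J. \<omega> i \<in> F i} \<in> sets P"
    using J by (intro sets.sets_Collect_finite_All) (auto intro!: measurable_sets_Collect[OF coord_measurable])
  moreover have "emeasure P {\<omega>\<in>space P. \<forall>i\<in>(\<lambda>i. i + a) ` J. \<omega> i \<in> F (i - a)} = (\<Prod>i\<in>J. emeasure M (F i))"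
    using J by (subst path_cylinder) (auto simp: prod.reindex inj_on_def)
  ultimately show "emeasure (distr P P (shift a)) {\<omega> \<in> space P. \<forall>i\<in>J. \<omega> i \<in> F i} = (\<Prod>i\<in>J. emeasure M (F i))"
    by (simp only: emeasure_distr[OF shift_measurable])
qed simp

text \<open>
  The coordinates are independent and identically distributed, so replacing those after time \<open>k\<close> by an independent copy
  does not change the law. On a cylinder, the product over its coordinates is split at \<open>k\<close>.
\<close>
lemma distr_splice: "distr (P \<Otimes>\<^sub>M P) P (\<lambda>z. splice k (fst z) (snd z)) = P"
proof (rule path_eqI)
  fix J :: "int set" and F :: "int \<Rightarrow> 'a set" assume J: "finite J" "\<And>i. i \<in> J \<Longrightarrow> F i \<in> sets M"
  have m: "{\<omega> \<in> space P. \<forall>i\<in>K. \<omega> i \<in> F i} \<in> sets P" if "K \<subseteq> J" for K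
    using J that by (intro sets.sets_Collect_finite_All)
      (auto intro!: measurable_sets_Collect[OF coord_measurable] intro: finite_subset)
  have "(\<lambda>z. splice k (fst z) (snd z)) -` {\<omega> \<in> space P. \<forall>i\<in>J. \<omega> i \<in> F i} \<inter> space (P \<Otimes>\<^sub>M P)
     = {\<omega> \<in> space P. \<forall>i\<in>J \<inter> {..k}. \<omega> i \<in> F i} \<times> {\<omega> \<in> space P. \<forall>i\<in>J - {..k}. \<omega> i \<in> F i}"
    by (auto simp: splice_def space_path space_pair_measure split: if_splits)
  then have "emeasure (distr (P \<Otimes>\<^sub>M P) P (\<lambda>z. splice k (fst z) (snd z))) {\<omega> \<in> space P. \<forall>i\<in>J. \<omega> i \<in> F i}
     = (\<Prod>i\<in>J\<inter>{..k}. emeasure M (F i)) * (\<Prod>i\<in>J-{..k}. emeasure M (F i))"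
    using J m[of J] m[of "J\<inter>{..k}"] m[of "J-{..k}"]
    by (simp add: emeasure_distr path.emeasure_pair_measure_Times) (subst (1 2) path_cylinder, auto)
  also have "\<dots> = (\<Prod>i\<in>J. emeasure M (F i))"
    using prod.Int_Diff[OF J(1), of "\<lambda>i. emeasure M (F i)" "{..k}"] by simp
  finally show "emeasure (distr (P \<Otimes>\<^sub>M P) P (\<lambda>z. splice k (fst z) (snd z))) {\<omega> \<in> space P. \<forall>i\<in>J. \<omega> i \<in> F i}
     = (\<Prod>i\<in>J. emeasure M (F i))" .
qed simp

lemma distr_coord: "distr P M (\<lambda>\<omega>. \<omega> i) = M"
  unfolding path_space_def by (rule distr_PiM_component) (auto simp: prob_space_axioms)

lemma integral_shift:
  assumes "g \<in> borel_measurable P"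
  shows "(\<integral>\<omega>. g (shift a \<omega>) \<partial>P) = (\<integral>\<omega>. (g \<omega> :: real) \<partial>P)"
  using integral_distr[OF shift_measurable[of a], of g] assms by (simp add: distr_shift)

lemma AE_shift:
  assumes "AE \<omega> in P. Q \<omega>"
  shows "AE \<omega> in P. Q (shift a \<omega>)"
  using assms by (intro AE_distrD[OF shift_measurable[of a]]) (simp only: distr_shift)

lemma AE_splice:
  assumes "AE \<omega> in P. Q \<omega>"
  shows "AE \<omega> in P. AE \<omega>' in P. Q (splice k \<omega> \<omega>')"
proof -
  have "AE z in P \<Otimes>\<^sub>M P. Q (splice k (fst z) (snd z))"
    using assms by (intro AE_distrD[OF splice_measurable[of k]]) (simp only: distr_splice)
  from pair.AE_pair[OF this] show ?thesis by simp
qed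

lemma nn_integral_coord:
  assumes "g \<in> borel_measurable M"
  shows "(\<integral>\<^sup>+\<omega>. g (\<omega> i) \<partial>P) = (\<integral>\<^sup>+x. g x \<partial>M)"
  using nn_integral_distr[OF coord_measurable[of i], of g] assms by (simp add: distr_coord)

lemma nn_integral_splice:
  assumes "g \<in> borel_measurable P"
  shows "(\<integral>\<^sup>+\<omega>. \<integral>\<^sup>+\<omega>'. g (splice k \<omega> \<omega>') \<partial>P \<partial>P) = (\<integral>\<^sup>+\<omega>. g \<omega> \<partial>P)"
proof -
  have "(\<integral>\<^sup>+\<omega>. g \<omega> \<partial>P) = (\<integral>\<^sup>+z. g (splice k (fst z) (snd z)) \<partial>(P \<Otimes>\<^sub>M P))"
    using nn_integral_distr[OF splice_measurable[of k], of g] assms by (simp add: distr_splice)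
  also have "\<dots> = (\<integral>\<^sup>+\<omega>. \<integral>\<^sup>+\<omega>'. g (splice k \<omega> \<omega>') \<partial>P \<partial>P)"
    using measurable_compose[OF splice_measurable[of k] assms]
    by (subst path.nn_integral_fst[symmetric]) auto
  finally show ?thesis by simp
qed

lemma integrable_splice:
  assumes "integrable P g"
  shows "integrable (P \<Otimes>\<^sub>M P) (\<lambda>z. g (splice k (fst z) (snd z)) :: real)"
  using integrable_distr[OF splice_measurable[of k], of g] assms by (simp add: distr_splice)

lemma integral_splice:
  assumes "integrable P g"
  shows "(\<integral>\<omega>. \<integral>\<omega>'. g (splice k \<omega> \<omega>') \<partial>P \<partial>P) = (\<integral>\<omega>. (g \<omega> :: real) \<partial>P)"
proof -
  have "(\<integral>\<omega>. g \<omega> \<partial>P) = (\<integral>z. g (splice k (fst z) (snd z)) \<partial>(P \<Otimes>\<^sub>M P))"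
    using integral_distr[OF splice_measurable[of k], of g] assms by (simp add: distr_splice)
  also have "\<dots> = (\<integral>\<omega>. \<integral>\<omega>'. g (splice k \<omega> \<omega>') \<partial>P \<partial>P)"
    using integrable_splice[OF assms, of k]
    by (subst pair.integral_fst'[symmetric]) (auto simp: case_prod_beta')
  finally show ?thesis by simp
qed

lemma space_past[simp]: "space (past M k) = space P"
  unfolding past_def by (auto simp: space_measure_of_conv)

lemma past_gen: "(\<Union>j\<in>{..k}. {(\<lambda>\<omega>. \<omega> j) -` A \<inter> space P | A. A \<in> sets M}) \<subseteq> Pow (space P)"
  by auto

lemma sets_past: "sets (past M k) = sigma_sets (space P)
   (\<Union>j\<in>{..k}. {(\<lambda>\<omega>. \<omega> j) -` A \<inter> space P | A. A \<in> sets M})"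
  unfolding past_def by (rule sets_measure_of[OF past_gen])

lemma coord_past: "j \<le> k \<Longrightarrow> (\<lambda>\<omega>. \<omega> j) \<in> measurable (past M k) M"
  by (rule measurableI) (auto simp: space_path sets_past)

lemma measurable_pastI:
  assumes "g \<in> space N \<rightarrow> space P" "\<And>j. j \<le> k \<Longrightarrow> (\<lambda>x. g x j) \<in> measurable N M"
  shows "g \<in> measurable N (past M k)"
  unfolding past_def
proof (rule measurable_measure_of[OF past_gen assms(1)])
  fix B assume "B \<in> (\<Union>j\<in>{..k}. {(\<lambda>\<omega>. \<omega> j) -` A \<inter> space P | A. A \<in> sets M})"
  then obtain j A where "j \<le> k" "A \<in> sets M" and B: "B = (\<lambda>\<omega>. \<omega> j) -` A \<inter> space P" by auto
  then have "(\<lambda>x. g x j) -` A \<inter> space N \<in> sets N"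
    using measurable_sets[OF assms(2)] by auto
  also have "(\<lambda>x. g x j) -` A \<inter> space N = g -` B \<inter> space N"
    using assms(1) by (auto simp: B)
  finally show "g -` B \<inter> space N \<in> sets N" .
qed

lemma subalgebra_past: "subalgebra P (past M k)"
proof -
  have "(\<lambda>\<omega>. \<omega>) \<in> measurable P (past M k)"
    by (rule measurable_pastI) (auto intro: coord_measurable)
  from measurable_sets[OF this] sets.sets_into_space[of _ "past M k"] show ?thesis
    unfolding subalgebra_def by (auto simp: Int_absorb2)
qed

lemma subalgebra_past_mono:
  assumes "k \<le> l"
  shows "subalgebra (past M l) (past M k)"
proof -
  have "(\<lambda>\<omega>. \<omega>) \<in> measurable (past M l) (past M k)"
    using assms by (intro measurable_pastI) (auto intro: coord_past)
  from measurable_sets[OF this] sets.sets_into_space[of _ "past M k"] show ?thesis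
    unfolding subalgebra_def by (auto simp: Int_absorb2)
qed

lemma past_mono:
  assumes "k \<le> l"
  shows "measurable (past M k) N \<subseteq> measurable (past M l) N"
  using measurable_from_subalg[OF subalgebra_past_mono[OF assms]] by blast

lemma past_path: "measurable (past M k) N \<subseteq> measurable P N"
  using measurable_from_subalg[OF subalgebra_past] by blast

lemma shift_past: "shift a \<in> measurable (past M (k + a)) (past M k)"
  by (intro measurable_pastI) (auto simp: shift_def space_path intro: coord_past)

text \<open>
  Events of \<open>\<F>\<^sub>k\<close> do not see the coordinates after \<open>k\<close>: true on the generators, and preserved by complements
  and countable unions.
\<close>
lemma splice_in_past:
  assumes "\<omega> \<in> space P" "\<omega>' \<in> space P" "A \<in> sets (past M k)"
  shows "splice k \<omega> \<omega>' \<in> A \<longleftrightarrow> \<omega> \<in> A"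
  using assms(3) unfolding sets_past
proof (induction rule: sigma_sets.induct)
  case (Basic B)
  then show ?case using assms by (auto simp: splice_def space_path)
next
  case (Compl B)
  then show ?case using assms by (auto simp: splice_def space_path)
qed auto

lemma splice_past:
  fixes g :: "(int \<Rightarrow> 'a) \<Rightarrow> real"
  assumes "\<omega> \<in> space P" "\<omega>' \<in> space P" "g \<in> borel_measurable (past M k)"
  shows "g (splice k \<omega> \<omega>') = g \<omega>"
proof -
  have "g -` {g \<omega>} \<inter> space (past M k) \<in> sets (past M k)"
    by (rule measurable_sets[OF assms(3)]) auto
  from splice_in_past[OF assms(1,2) this] assms(1) show ?thesis by auto
qed

sublocale past: finite_measure_subalgebra P "past M k" for k
  by unfold_locales (rule subalgebra_past)

text \<open>
  An everywhere defined version of the conditional expectation given \<open>\<F>\<^sub>k\<close> (see \<open>avg_eq_cond_exp\<close>), which can be estimated under the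
  integral sign.
\<close>
definition avg :: "int \<Rightarrow> ((int \<Rightarrow> 'a) \<Rightarrow> real) \<Rightarrow> (int \<Rightarrow> 'a) \<Rightarrow> real" where
  "avg k g \<omega> = (\<integral>\<omega>'. g (splice k \<omega> \<omega>') \<partial>P)"

lemma avg_past:
  assumes "g \<in> borel_measurable P"
  shows "avg k g \<in> borel_measurable (past M k)"
proof -
  have "(\<lambda>z. splice k (fst z) (snd z)) \<in> measurable (past M k \<Otimes>\<^sub>M P) P"
    unfolding measurable_path_iff splice_def
  proof
    fix i show "(\<lambda>z. if i \<le> k then fst z i else snd z i) \<in> measurable (past M k \<Otimes>\<^sub>M P) M"
      by (cases "i \<le> k") (auto intro!: measurable_compose[OF measurable_fst coord_past]
        measurable_compose[OF measurable_snd coord_measurable])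
  qed
  from measurable_compose[OF this assms] show ?thesis
    unfolding avg_def by (intro path.borel_measurable_lebesgue_integral) (auto simp: case_prod_beta')
qed

text \<open>
  \<open>G\<close> is unchanged by splicing at \<open>k\<close>, so Fubini's theorem and the invariance of the law apply to \<open>G * g\<close>.
\<close>
lemma integral_mult_avg:
  assumes G: "G \<in> borel_measurable (past M k)" and g: "integrable P (\<lambda>\<omega>. G \<omega> * g \<omega>)"
  shows "integrable P (\<lambda>\<omega>. G \<omega> * avg k g \<omega>)"
    "(\<integral>\<omega>. G \<omega> * avg k g \<omega> \<partial>P) = (\<integral>\<omega>. G \<omega> * g \<omega> \<partial>P)"
proof -
  have *: "(\<integral>\<omega>'. G (splice k \<omega> \<omega>') * g (splice k \<omega> \<omega>') \<partial>P) = G \<omega> * avg k g \<omega>" if "\<omega> \<in> space P" for \<omega>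
  proof -
    have "(\<integral>\<omega>'. G (splice k \<omega> \<omega>') * g (splice k \<omega> \<omega>') \<partial>P) = (\<integral>\<omega>'. G \<omega> * g (splice k \<omega> \<omega>') \<partial>P)"
      by (rule Bochner_Integration.integral_cong) (auto simp: splice_past[OF that _ G])
    then show ?thesis by (simp add: avg_def)
  qed
  have "integrable P (\<lambda>\<omega>. \<integral>\<omega>'. G (splice k \<omega> \<omega>') * g (splice k \<omega> \<omega>') \<partial>P)"
    using pair.integrable_fst'[OF integrable_splice[OF g, of k]] by simp
  then show "integrable P (\<lambda>\<omega>. G \<omega> * avg k g \<omega>)"
    by (subst (asm) Bochner_Integration.integrable_cong[OF refl *]) auto
  have "(\<integral>\<omega>. G \<omega> * avg k g \<omega> \<partial>P) = (\<integral>\<omega>. \<integral>\<omega>'. G (splice k \<omega> \<omega>') * g (splice k \<omega> \<omega>') \<partial>P \<partial>P)"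
    by (rule Bochner_Integration.integral_cong) (auto simp: *)
  also have "\<dots> = (\<integral>\<omega>. G \<omega> * g \<omega> \<partial>P)" by (rule integral_splice[OF g])
  finally show "(\<integral>\<omega>. G \<omega> * avg k g \<omega> \<partial>P) = (\<integral>\<omega>. G \<omega> * g \<omega> \<partial>P)" .
qed

lemma avg_eq_cond_exp:
  assumes g: "integrable P g"
  shows "AE \<omega> in P. real_cond_exp P (past M k) g \<omega> = avg k g \<omega>"
proof (rule past.real_cond_exp_charact)
  have [measurable]: "g \<in> borel_measurable P" using g by simp
  show "integrable P (avg k g)"
    using integral_mult_avg(1)[of "\<lambda>_. 1" k g] g by simp
  show "avg k g \<in> borel_measurable (past M k)" by (rule avg_past) simp
  fix A assume A: "A \<in> sets (past M k)"
  then have "A \<in> sets P" using subalgebra_past[of k] by (auto simp: subalgebra_def)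
  then have "integrable P (\<lambda>\<omega>. indicator A \<omega> * g \<omega>)"
    using integrable_mult_indicator[of A P g] g by simp
  from integral_mult_avg(2)[of "indicator A" k g, OF _ this] A
  show "set_lebesgue_integral P A g = set_lebesgue_integral P A (avg k g)"
    by (simp add: set_lebesgue_integral_def)
qed (rule g)

lemma avg_shift:
  assumes "\<omega> \<in> space P" "g \<in> borel_measurable P"
  shows "avg k g (shift a \<omega>) = avg (k + a) (\<lambda>\<omega>. g (shift a \<omega>)) \<omega>"
proof -
  have *: "shift a (splice (k + a) \<omega> \<omega>') = splice k (shift a \<omega>) (shift a \<omega>')" for \<omega>'
    by (auto simp: shift_def splice_def)
  have "shift a \<omega> \<in> space P" using assms by (auto simp: space_path shift_def)
  from measurable_compose[OF splice_measurable2[OF this] assms(2)]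
  show ?thesis unfolding avg_def * by (subst integral_shift) auto
qed

text \<open>
  Independence of a later coordinate from \<open>\<F>\<^sub>k\<close>: after splicing at \<open>k\<close>, the event depends on \<open>\<omega>\<close> and the
  coordinate on \<open>\<omega>'\<close>.
\<close>
lemma nn_integral_past_coord:
  assumes "A \<in> sets (past M k)" "k < i" "g \<in> borel_measurable M"
  shows "(\<integral>\<^sup>+\<omega>. indicator A \<omega> * g (\<omega> i) \<partial>P) = emeasure P A * (\<integral>\<^sup>+x. g x \<partial>M)"
proof -
  have A[measurable]: "A \<in> sets P" using subalgebra_past[of k] assms by (auto simp: subalgebra_def)
  note assms(3)[measurable]
  have "(\<integral>\<^sup>+\<omega>. indicator A \<omega> * g (\<omega> i) \<partial>P)
    = (\<integral>\<^sup>+\<omega>. \<integral>\<^sup>+\<omega>'. indicator A (splice k \<omega> \<omega>') * g (splice k \<omega> \<omega>' i) \<partial>P \<partial>P)"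
    by (rule nn_integral_splice[symmetric]) simp
  also have "\<dots> = (\<integral>\<^sup>+\<omega>. \<integral>\<^sup>+\<omega>'. indicator A \<omega> * g (\<omega>' i) \<partial>P \<partial>P)"
    using assms splice_in_past[of _ _ A k]
    by (intro nn_integral_cong) (auto simp: splice_def indicator_def split: if_splits)
  also have "\<dots> = emeasure P A * (\<integral>\<^sup>+x. g x \<partial>M)"
    by (simp add: nn_integral_cmult nn_integral_multc nn_integral_coord)
  finally show ?thesis .
qed

end

section \<open>Pointwise bounds on the martingale increments\<close>

text \<open>
  Real majorants \<open>b j\<close> of the norms of \<open>|\<alpha>\<^sub>j|\<^sup>\<gamma>\<close>, instead of the extended norms, keep the series of norms in the reals. The sign of
  \<open>C\<close> is no restriction, since a Hoelder constant may be replaced by its absolute value.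
\<close>
locale hoelder_process = iid_path M for M :: "'a measure" +
  fixes \<gamma> C :: real and \<alpha> :: "nat \<Rightarrow> 'a \<Rightarrow> real" and f :: "real \<Rightarrow> real" and b :: "nat \<Rightarrow> real"
  assumes \<gamma>: "0 < \<gamma>" "\<gamma> \<le> 1"
    and \<alpha>[measurable]: "\<And>j. \<alpha> j \<in> borel_measurable M"
    and C: "0 \<le> C" "\<And>x y. \<bar>f x - f y\<bar> \<le> C * \<bar>x - y\<bar> powr \<gamma>"
    and b: "\<And>j. 0 \<le> b j" "summable b"
    and \<alpha>_le: "\<And>j. (\<integral>\<^sup>+x. ennreal ((\<bar>\<alpha> j x\<bar> powr \<gamma>)\<^sup>2) \<partial>M) \<le> ennreal ((b j)\<^sup>2)"
begin

definition h :: "nat \<Rightarrow> 'a \<Rightarrow> real" where "h j x = \<bar>\<alpha> j x\<bar> powr \<gamma>"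

text \<open>
  \<open>H j\<close> dominates the effect of resampling the coordinate that enters through \<open>\<alpha> j\<close>, and
  \<open>c j\<close> dominates its \<open>L\<^sup>2\<close> norm.
\<close>
definition H :: "nat \<Rightarrow> 'a \<Rightarrow> real" where "H j x = C * (h j x + expectation (h j))"

definition c :: "nat \<Rightarrow> real" where "c j = 2 * C * b j"

lemma h_measurable[measurable]: "h j \<in> borel_measurable M"
  unfolding h_def by measurable

lemma h_nonneg[simp]: "0 \<le> h j x" by (simp add: h_def)

lemma nn_h: "(\<integral>\<^sup>+x. ennreal ((h j x)\<^sup>2) \<partial>M) \<le> ennreal ((b j)\<^sup>2)"
  using \<alpha>_le by (simp add: h_def)

lemma integrable_h2: "integrable M (\<lambda>x. (h j x)\<^sup>2)"
  by (rule integrable_of_nn_integral[OF _ nn_h]) auto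

lemma integrable_h: "integrable M (h j)"
  by (rule integrable_of_square[OF _ integrable_h2]) simp

lemma Eh_nonneg[simp]: "0 \<le> expectation (h j)" by (simp add: integral_nonneg)

lemma h2_le: "(\<integral>x. (h j x)\<^sup>2 \<partial>M) \<le> (b j)\<^sup>2"
proof -
  have "ennreal (\<integral>x. (h j x)\<^sup>2 \<partial>M) = (\<integral>\<^sup>+x. ennreal ((h j x)\<^sup>2) \<partial>M)"
    using integrable_h2 by (intro nn_integral_eq_integral[symmetric]) auto
  also have "\<dots> \<le> ennreal ((b j)\<^sup>2)" by (rule nn_h)
  finally show ?thesis by simp
qed

lemma Eh2_le: "(expectation (h j))\<^sup>2 \<le> (b j)\<^sup>2"
  using variance_eq[OF integrable_h integrable_h2, of j] variance_positive[of "h j"] h2_le[of j] by linarith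

lemma Eh_le: "expectation (h j) \<le> b j"
  using Eh2_le b(1) by (rule power2_le_imp_le)

lemma H_measurable[measurable]: "H j \<in> borel_measurable M"
  unfolding H_def by measurable

lemma H_nonneg[simp]: "0 \<le> H j x" using C by (simp add: H_def)

lemma c_nonneg[simp]: "0 \<le> c j" using C b by (simp add: c_def)

lemma summable_c: "summable c" unfolding c_def using b by (intro summable_mult) auto

lemma nn_H: "(\<integral>\<^sup>+x. ennreal ((H j x)\<^sup>2) \<partial>M) \<le> ennreal ((c j)\<^sup>2)"
proof -
  let ?m = "expectation (h j)"
  have eq: "(\<lambda>x. (H j x)\<^sup>2) = (\<lambda>x. C\<^sup>2 * ((h j x)\<^sup>2 + 2 * ?m * h j x + ?m\<^sup>2))"
    by (auto simp: H_def power2_eq_square algebra_simps)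
  have "integrable M (\<lambda>x. (H j x)\<^sup>2)"
    unfolding eq using integrable_h integrable_h2 by auto
  then have "(\<integral>\<^sup>+x. ennreal ((H j x)\<^sup>2) \<partial>M) = ennreal (\<integral>x. (H j x)\<^sup>2 \<partial>M)"
    by (intro nn_integral_eq_integral) auto
  also have "(\<integral>x. (H j x)\<^sup>2 \<partial>M) = C\<^sup>2 * ((\<integral>x. (h j x)\<^sup>2 \<partial>M) + 3 * ?m\<^sup>2)"
    unfolding eq using integrable_h integrable_h2
    by (simp add: prob_space power2_eq_square algebra_simps)
  also have "\<dots> \<le> C\<^sup>2 * (4 * (b j)\<^sup>2)"
    using h2_le[of j] Eh2_le[of j] by (intro mult_left_mono) auto
  also have "\<dots> = (c j)\<^sup>2" by (simp add: c_def power2_eq_square)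
  finally show ?thesis by (simp add: ennreal_leI)
qed

text \<open>
  The expected square of the sum is finite by Minkowski's inequality. The coordinates \<open>\<kappa> j\<close> are arbitrary, because only
  their common law matters.
\<close>
lemma AE_summable_h: "AE \<omega> in P. summable (\<lambda>j. h j (\<omega> (\<kappa> j)))"
proof -
  have "(\<integral>\<^sup>+\<omega>. (\<Sum>j. ennreal (h j (\<omega> (\<kappa> j))))\<^sup>2 \<partial>P) \<le> ennreal ((\<Sum>j. b j)\<^sup>2)"
  proof (rule nn_integral_suminf_square_le)
    fix j
    show "(\<integral>\<^sup>+\<omega>. (ennreal (h j (\<omega> (\<kappa> j))))\<^sup>2 \<partial>P) \<le> ennreal ((b j)\<^sup>2)"
      using nn_h[of j] by (simp add: ennreal_power nn_integral_coord[of "\<lambda>x. ennreal ((h j x)\<^sup>2)"])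
  qed (use b in auto)
  then have "(\<integral>\<^sup>+\<omega>. (\<Sum>j. ennreal (h j (\<omega> (\<kappa> j))))\<^sup>2 \<partial>P) \<noteq> \<infinity>"
    by (auto simp: top_unique)
  then have "AE \<omega> in P. (\<Sum>j. ennreal (h j (\<omega> (\<kappa> j))))\<^sup>2 \<noteq> \<infinity>"
    by (intro nn_integral_PInf_AE) auto
  then show ?thesis
    by eventually_elim (auto intro!: summable_suminf_not_top simp: power2_eq_square ennreal_mult_eq_top_iff)
qed

lemma summable_H: "summable (\<lambda>j. h j (w j)) \<Longrightarrow> summable (\<lambda>j. H j (w j))"
  unfolding H_def
  using summable_comparison_test'[OF b(2), of 0 "\<lambda>j. expectation (h j)"]
  by (intro summable_mult summable_add) (auto simp: Eh_le)

lemma nn_sum_H: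
  "(\<integral>\<^sup>+\<omega>. (\<Sum>j. ennreal (H (j + n) (\<omega> (\<kappa> j))))\<^sup>2 \<partial>P) \<le> ennreal ((\<Sum>j. c (j + n))\<^sup>2)"
proof (rule nn_integral_suminf_square_le)
  fix j
  show "(\<integral>\<^sup>+\<omega>. (ennreal (H (j + n) (\<omega> (\<kappa> j))))\<^sup>2 \<partial>P) \<le> ennreal ((c (j + n))\<^sup>2)"
    using nn_H[of "j + n"] by (simp add: ennreal_power nn_integral_coord[of "\<lambda>x. ennreal ((H (j + n) x)\<^sup>2)"])
qed (auto intro: summable_ignore_initial_segment summable_c)

abbreviation "Y \<equiv> lin_proc \<alpha>"
abbreviation "X \<equiv> centred_proc M f Y"

lemma Y_eq: "Y i \<omega> = (\<Sum>j. \<alpha> j (\<omega> (i - int j)))"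
  by (simp add: lin_proc_def shift_def)

lemma f_measurable[measurable]: "f \<in> borel_measurable borel"
proof (rule borel_measurable_continuous_onI, unfold continuous_on_def, intro ballI)
  fix x
  have "((\<lambda>y. C * \<bar>y - x\<bar> powr \<gamma>) \<longlongrightarrow> C * \<bar>x - x\<bar> powr \<gamma>) (at x)"
    using \<gamma> by (intro tendsto_intros tendsto_powr') auto
  then have "((\<lambda>y. C * \<bar>y - x\<bar> powr \<gamma>) \<longlongrightarrow> 0) (at x)" by simp
  then have "((\<lambda>y. f y - f x) \<longlongrightarrow> 0) (at x)"
    by (rule Lim_null_comparison[rotated]) (auto intro!: always_eventually C)
  then show "(f \<longlongrightarrow> f x) (at x)" by (simp add: LIM_zero_iff)
qed

lemma Y_measurable[measurable]: "Y i \<in> borel_measurable P"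
  unfolding Y_eq[abs_def] by measurable

lemma X_measurable[measurable]: "X i \<in> borel_measurable P"
  unfolding centred_proc_def by measurable

lemma f_diff_le:
  assumes v: "summable (\<lambda>j. h j (v (i - int j)))" and w: "summable (\<lambda>j. h j (w (i - int j)))"
    and u: "summable u" "\<And>j. \<bar>\<alpha> j (v (i - int j)) - \<alpha> j (w (i - int j))\<bar> powr \<gamma> \<le> u j"
  shows "\<bar>f (Y i v) - f (Y i w)\<bar> \<le> C * (\<Sum>j. u j)"
proof -
  have s: "summable (\<lambda>j. \<alpha> j (v (i - int j)))" "summable (\<lambda>j. \<alpha> j (w (i - int j)))"
    using v w \<gamma> unfolding h_def by (blast intro: summable_of_powr)+
  have d: "summable (\<lambda>j. \<bar>\<alpha> j (v (i - int j)) - \<alpha> j (w (i - int j))\<bar> powr \<gamma>)"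
    by (rule summable_comparison_test'[OF u(1)]) (use u in auto)
  have "\<bar>f (Y i v) - f (Y i w)\<bar> \<le> C * \<bar>Y i v - Y i w\<bar> powr \<gamma>" by (rule C)
  also have "Y i v - Y i w = (\<Sum>j. \<alpha> j (v (i - int j)) - \<alpha> j (w (i - int j)))"
    unfolding Y_eq using s by (rule suminf_diff)
  also have "C * \<bar>\<dots>\<bar> powr \<gamma> \<le> C * (\<Sum>j. \<bar>\<alpha> j (v (i - int j)) - \<alpha> j (w (i - int j))\<bar> powr \<gamma>)"
    using suminf_powr_le[OF \<gamma> d] C by (intro mult_left_mono)
  also have "\<dots> \<le> C * (\<Sum>j. u j)"
    using C u d by (intro mult_left_mono suminf_le) auto
  finally show ?thesis .
qed

lemma alpha_diff_le: "\<bar>\<alpha> j x - \<alpha> j y\<bar> powr \<gamma> \<le> h j x + h j y"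
proof -
  have "\<bar>\<alpha> j x - \<alpha> j y\<bar> powr \<gamma> \<le> (\<bar>\<alpha> j x\<bar> + \<bar>\<alpha> j y\<bar>) powr \<gamma>"
    using \<gamma> by (intro powr_mono2) auto
  also have "\<dots> \<le> h j x + h j y"
    unfolding h_def using \<gamma> by (intro powr_add_le) auto
  finally show ?thesis .
qed

lemma fY_square: "integrable P (\<lambda>\<omega>. (f (Y i \<omega>))\<^sup>2)"
proof (rule integrable_of_nn_integral)
  have "AE \<omega> in P. ennreal ((f (Y i \<omega>))\<^sup>2) \<le>
     2 * ennreal ((f 0)\<^sup>2) + 2 * (\<Sum>j. ennreal (H (j + 0) (\<omega> (i - int j))))\<^sup>2"
    using AE_summable_h[of "\<lambda>j. i - int j"]
  proof eventually_elim
    case (elim \<omega>)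
    have sH: "summable (\<lambda>j. H j (\<omega> (i - int j)))" by (rule summable_H[OF elim])
    have "\<bar>f (Y i \<omega>) - f 0\<bar> \<le> C * \<bar>Y i \<omega> - 0\<bar> powr \<gamma>" by (rule C)
    also have "\<dots> \<le> C * (\<Sum>j. h j (\<omega> (i - int j)))"
      using suminf_powr_le[OF \<gamma> elim[unfolded h_def]] C
      by (intro mult_left_mono) (auto simp: Y_eq h_def)
    also have "\<dots> = (\<Sum>j. C * h j (\<omega> (i - int j)))" using elim by (rule suminf_mult[symmetric])
    also have "\<dots> \<le> (\<Sum>j. H j (\<omega> (i - int j)))"
      using elim C by (intro suminf_le sH summable_mult) (auto simp: H_def intro!: mult_left_mono)
    finally have "\<bar>f (Y i \<omega>)\<bar> \<le> \<bar>f 0\<bar> + (\<Sum>j. H j (\<omega> (i - int j)))" by linarith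
    then have "ennreal \<bar>f (Y i \<omega>)\<bar> \<le> ennreal \<bar>f 0\<bar> + (\<Sum>j. ennreal (H j (\<omega> (i - int j))))"
      using sH by (simp add: suminf_ennreal2 ennreal_plus[symmetric] suminf_nonneg ennreal_leI del: ennreal_plus)
    then have "(ennreal \<bar>f (Y i \<omega>)\<bar>)\<^sup>2 \<le> (ennreal \<bar>f 0\<bar> + (\<Sum>j. ennreal (H j (\<omega> (i - int j)))))\<^sup>2"
      by (rule power_mono) simp
    also have "\<dots> \<le> 2 * (ennreal \<bar>f 0\<bar>)\<^sup>2 + 2 * (\<Sum>j. ennreal (H j (\<omega> (i - int j))))\<^sup>2"
      by (rule ennreal_square_add_le)
    finally show ?case by (simp add: ennreal_power)
  qed
  then have "(\<integral>\<^sup>+\<omega>. ennreal ((f (Y i \<omega>))\<^sup>2) \<partial>P) \<le>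
     (\<integral>\<^sup>+\<omega>. 2 * ennreal ((f 0)\<^sup>2) + 2 * (\<Sum>j. ennreal (H (j + 0) (\<omega> (i - int j))))\<^sup>2 \<partial>P)"
    by (rule nn_integral_mono_AE)
  also have "\<dots> \<le> 2 * ennreal ((f 0)\<^sup>2) + 2 * ennreal ((\<Sum>j. c (j + 0))\<^sup>2)"
    using nn_sum_H[of 0 "\<lambda>j. i - int j"]
    by (simp add: nn_integral_add nn_integral_cmult path.emeasure_space_1 add_left_mono mult_left_mono)
  also have "\<dots> = ennreal (2 * (f 0)\<^sup>2 + 2 * (\<Sum>j. c (j + 0))\<^sup>2)"
    by (simp add: ennreal_mult)
  finally show "(\<integral>\<^sup>+\<omega>. ennreal ((f (Y i \<omega>))\<^sup>2) \<partial>P) \<le> ennreal (2 * (f 0)\<^sup>2 + 2 * (\<Sum>j. c (j + 0))\<^sup>2)" .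
qed auto

lemma fY_integrable: "integrable P (\<lambda>\<omega>. f (Y i \<omega>))"
  by (rule path.integrable_of_square[OF _ fY_square]) simp

lemma X_square: "integrable P (\<lambda>\<omega>. (X i \<omega>)\<^sup>2)"
  unfolding centred_proc_def power2_diff using fY_square fY_integrable by auto

lemma X_integrable: "integrable P (X i)"
  by (rule path.integrable_of_square[OF _ X_square]) simp

lemma X_mean: "(\<integral>\<omega>. X i \<omega> \<partial>P) = 0"
  unfolding centred_proc_def using fY_integrable by (simp add: path.prob_space)

lemma X_shift: "X i (shift a \<omega>) = X (i + a) \<omega>"
proof -
  have *: "Y i (shift a \<omega>) = Y (i + a) \<omega>" for \<omega>
    unfolding Y_eq by (simp add: shift_def algebra_simps)
  have "(\<integral>\<omega>. f (Y i \<omega>) \<partial>P) = (\<integral>\<omega>. f (Y (i + a) \<omega>) \<partial>P)"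
    using integral_shift[of "\<lambda>\<omega>. f (Y i \<omega>)" a] by (simp add: *)
  then show ?thesis by (simp add: centred_proc_def *)
qed

text \<open>
  The resampling estimate. The paths \<open>v \<omega>'\<close> and \<open>w \<omega>'\<close> may differ only in the coordinates that enter \<open>Y i\<close> with a lag \<open>j \<in> J\<close>,
  where the first carries the value of \<open>\<omega>\<close> and the second that of the independent copy \<open>\<omega>'\<close>. Integrating \<open>\<omega>'\<close> out turns
  \<open>|\<alpha>\<^sub>j|\<^sup>\<gamma>\<close> at the copy into its expectation.
\<close>
lemma coupling_bound:
  assumes sv: "AE \<omega>' in P. summable (\<lambda>j. h j (v \<omega>' (i - int j)))"
    and sw: "AE \<omega>' in P. summable (\<lambda>j. h j (w \<omega>' (i - int j)))"
    and iv: "integrable P (\<lambda>\<omega>'. X i (v \<omega>'))" and iw: "integrable P (\<lambda>\<omega>'. X i (w \<omega>'))"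
    and s: "summable (\<lambda>j. h j (\<omega> (i - int j)))"
    and J: "\<And>j \<omega>'. j \<in> J \<Longrightarrow> v \<omega>' (i - int j) = \<omega> (i - int j) \<and> w \<omega>' (i - int j) = \<omega>' (i - int j)"
    and nJ: "\<And>j \<omega>'. j \<notin> J \<Longrightarrow> v \<omega>' (i - int j) = w \<omega>' (i - int j)"
  shows "\<bar>(\<integral>\<omega>'. X i (v \<omega>') \<partial>P) - (\<integral>\<omega>'. X i (w \<omega>') \<partial>P)\<bar> \<le> (\<Sum>j. if j \<in> J then H j (\<omega> (i - int j)) else 0)"
proof -
  have sH: "summable (\<lambda>j. if j \<in> J then H j (\<omega> (i - int j)) else 0)"
    by (rule summable_comparison_test'[OF summable_H[OF s]]) auto
  let ?u = "\<lambda>\<omega>' j. if j \<in> J then h j (\<omega> (i - int j)) + h j (\<omega>' (i - int j)) else 0"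
  have bound: "AE \<omega>' in P. ennreal \<bar>X i (v \<omega>') - X i (w \<omega>')\<bar> \<le> (\<Sum>j. ennreal (C * ?u \<omega>' j))"
    using sv sw AE_summable_h[of "\<lambda>j. i - int j"]
  proof eventually_elim
    case (elim \<omega>')
    have su: "summable (?u \<omega>')"
      by (rule summable_comparison_test'[OF summable_add[OF s elim(3)]]) auto
    have "\<bar>f (Y i (v \<omega>')) - f (Y i (w \<omega>'))\<bar> \<le> C * (\<Sum>j. ?u \<omega>' j)"
      by (rule f_diff_le[OF elim(1,2) su]) (use J nJ \<gamma> in \<open>auto simp: alpha_diff_le\<close>)
    then show ?case
      using su C by (subst suminf_ennreal2) (auto simp: centred_proc_def suminf_mult intro!: ennreal_leI summable_mult)
  qed
  have "ennreal \<bar>(\<integral>\<omega>'. X i (v \<omega>') \<partial>P) - (\<integral>\<omega>'. X i (w \<omega>') \<partial>P)\<bar>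
      = ennreal (norm (\<integral>\<omega>'. X i (v \<omega>') - X i (w \<omega>') \<partial>P))"
    using iv iw by simp
  also have "\<dots> \<le> (\<integral>\<^sup>+\<omega>'. ennreal (norm (X i (v \<omega>') - X i (w \<omega>'))) \<partial>P)"
    using iv iw by (intro integral_norm_bound_ennreal) auto
  also have "\<dots> \<le> (\<integral>\<^sup>+\<omega>'. (\<Sum>j. ennreal (C * ?u \<omega>' j)) \<partial>P)"
    using bound by (intro nn_integral_mono_AE) simp
  also have "\<dots> = (\<Sum>j. \<integral>\<^sup>+\<omega>'. ennreal (C * ?u \<omega>' j) \<partial>P)"
    by (intro nn_integral_suminf) auto
  also have "\<dots> = (\<Sum>j. ennreal (if j \<in> J then H j (\<omega> (i - int j)) else 0))"
  proof (intro suminf_cong)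
    fix j
    have "(\<integral>\<^sup>+\<omega>'. ennreal (C * (h j (\<omega> (i - int j)) + h j (\<omega>' (i - int j)))) \<partial>P) = ennreal (H j (\<omega> (i - int j)))"
    proof -
      have "(\<integral>\<^sup>+\<omega>'. ennreal (C * (h j (\<omega> (i - int j)) + h j (\<omega>' (i - int j)))) \<partial>P)
        = (\<integral>\<^sup>+x. ennreal (C * (h j (\<omega> (i - int j)) + h j x)) \<partial>M)"
        by (rule nn_integral_coord[of "\<lambda>x. ennreal (C * (h j (\<omega> (i - int j)) + h j x))"]) simp
      also have "\<dots> = ennreal (\<integral>x. C * (h j (\<omega> (i - int j)) + h j x) \<partial>M)"
        using integrable_h C by (intro nn_integral_eq_integral) auto
      finally show ?thesis using integrable_h by (simp add: H_def prob_space)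
    qed
    then show "(\<integral>\<^sup>+\<omega>'. ennreal (C * ?u \<omega>' j) \<partial>P) = ennreal (if j \<in> J then H j (\<omega> (i - int j)) else 0)"
      by simp
  qed
  also have "\<dots> = ennreal (\<Sum>j. if j \<in> J then H j (\<omega> (i - int j)) else 0)"
    using sH by (intro suminf_ennreal2) auto
  finally show ?thesis
    using sH by (subst (asm) ennreal_le_iff) (auto intro!: suminf_nonneg)
qed

lemma AE_integrable_splice: "AE \<omega> in P. integrable P (\<lambda>\<omega>'. X i (splice k \<omega> \<omega>'))"
  using pair.AE_integrable_fst'[OF integrable_splice[OF X_integrable, of i k]] by simp

text \<open>
  \<open>d k\<close> is a version of \<open>P0 M (X k)\<close>, and \<open>\<xi> k a\<close> the same projection at time \<open>a\<close>, that is, of the variable \<open>X (k + a)\<close>.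
\<close>
definition d :: "nat \<Rightarrow> (int \<Rightarrow> 'a) \<Rightarrow> real" where
  "d k \<omega> = avg 0 (X (int k)) \<omega> - avg (-1) (X (int k)) \<omega>"

definition \<xi> :: "nat \<Rightarrow> int \<Rightarrow> (int \<Rightarrow> 'a) \<Rightarrow> real" where
  "\<xi> k a \<omega> = d k (shift a \<omega>)"

lemma \<xi>_eq:
  assumes "\<omega> \<in> space P"
  shows "\<xi> k a \<omega> = avg a (X (int k + a)) \<omega> - avg (a - 1) (X (int k + a)) \<omega>"
  using assms by (simp add: \<xi>_def d_def avg_shift X_shift)

lemma d_past: "d k \<in> borel_measurable (past M 0)"
proof -
  have "avg (-1) (X (int k)) \<in> borel_measurable (past M 0)"
    using avg_past[of "X (int k)" "-1"] past_mono[of "-1" 0] by (auto simp: subset_iff)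
  then show ?thesis unfolding d_def[abs_def] by (intro borel_measurable_diff avg_past) auto
qed

lemma \<xi>_past: "a \<le> l \<Longrightarrow> \<xi> k a \<in> borel_measurable (past M l)"
  using measurable_compose[OF shift_past[of a 0] d_past[of k]] past_mono[of a l]
  unfolding \<xi>_def[abs_def] by (auto simp: subset_iff)

lemma \<xi>_measurable[measurable]: "\<xi> k a \<in> borel_measurable P"
  using \<xi>_past[of a a k] past_path by auto

text \<open>
  The two averages resample the coordinates after \<open>0\<close> and after \<open>-1\<close>; with the same copy \<open>\<omega>'\<close> in both, the paths differ only
  at time \<open>0\<close>, which enters \<open>Y k\<close> with lag \<open>k\<close>.
\<close>
lemma d_bound: "AE \<omega> in P. \<bar>d k \<omega>\<bar> \<le> H k (\<omega> 0)"
proof -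
  note S = AE_summable_h[of "\<lambda>j. int k - int j"]
  show ?thesis
    using AE_splice[OF S, of 0] AE_splice[OF S, of "-1"] S
      AE_integrable_splice[of "int k" 0] AE_integrable_splice[of "int k" "-1"]
  proof eventually_elim
    case (elim \<omega>)
    have "\<bar>avg 0 (X (int k)) \<omega> - avg (-1) (X (int k)) \<omega>\<bar>
        \<le> (\<Sum>j. if j \<in> {k} then H j (\<omega> (int k - int j)) else 0)"
      unfolding avg_def by (rule coupling_bound[OF elim(1,2,4,5,3)]) (auto simp: splice_def)
    also have "\<dots> = H k (\<omega> 0)" by (subst suminf_finite[of "{k}"]) auto
    finally show ?case by (simp add: d_def)
  qed
qed

lemma \<xi>_bound: "AE \<omega> in P. \<bar>\<xi> k a \<omega>\<bar> \<le> H k (\<omega> a)"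
  using AE_shift[OF d_bound[of k], of a] by (simp add: \<xi>_def shift_def)

text \<open>
  Here the copy \<open>\<omega>'\<close> itself is the second path, which replaces the whole past up to \<open>-K\<close>; its average is \<open>E (X 0) = 0\<close>.
\<close>
lemma avg_tail: "AE \<omega> in P. \<bar>avg (- int K) (X 0) \<omega>\<bar> \<le> (\<Sum>j. if j \<in> {K..} then H j (\<omega> (0 - int j)) else 0)"
proof -
  note S = AE_summable_h[of "\<lambda>j. 0 - int j"]
  show ?thesis
    using AE_splice[OF S, of "- int K"] S AE_integrable_splice[of 0 "- int K"]
  proof eventually_elim
    case (elim \<omega>)
    have "\<bar>avg (- int K) (X 0) \<omega> - (\<integral>\<omega>'. X 0 \<omega>' \<partial>P)\<bar>
        \<le> (\<Sum>j. if j \<in> {K..} then H j (\<omega> (0 - int j)) else 0)"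
      unfolding avg_def
      by (rule coupling_bound[OF elim(1) S elim(3) X_integrable elim(2)]) (auto simp: splice_def)
    then show ?case by (simp add: X_mean)
  qed
qed

text \<open>
  The partial sums telescope to \<open>X 0 - avg (-K) (X 0)\<close>, and the remainder is bounded by the tail of a convergent series.
\<close>
lemma X0_sums: "AE \<omega> in P. (\<lambda>k. \<xi> k (- int k) \<omega>) sums X 0 \<omega>"
proof -
  have "AE \<omega> in P. \<forall>K. \<bar>avg (- int K) (X 0) \<omega>\<bar> \<le> (\<Sum>j. if j \<in> {K..} then H j (\<omega> (0 - int j)) else 0)"
    using avg_tail by (simp add: AE_all_countable)
  then show ?thesis
    using AE_summable_h[of "\<lambda>j. 0 - int j"] AE_space
  proof eventually_elim
    case (elim \<omega>)
    let ?H = "\<lambda>j. H j (\<omega> (0 - int j))"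
    have sH: "summable ?H" by (rule summable_H[OF elim(2)])
    have part: "(\<Sum>k<K. \<xi> k (- int k) \<omega>) = X 0 \<omega> - avg (- int K) (X 0) \<omega>" for K
    proof (induction K)
      case 0
      have "X 0 (splice 0 \<omega> \<omega>') = X 0 \<omega>" for \<omega>'
        by (simp add: centred_proc_def Y_eq splice_def)
      then show ?case by (simp add: avg_def path.prob_space)
    next
      case (Suc K)
      have *: "- int K - 1 = - int (Suc K)" by simp
      show ?case using Suc \<xi>_eq[OF elim(3), of K "- int K"] unfolding * by simp
    qed
    have tail: "(\<Sum>j. if j \<in> {K..} then ?H j else 0) = (\<Sum>j. ?H j) - (\<Sum>j<K. ?H j)" for K
    proof -
      have "(\<Sum>j. if j \<in> {K..} then ?H j else 0) = (\<Sum>j. ?H j - (if j \<in> {..<K} then ?H j else 0))"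
        by (intro suminf_cong) auto
      also have "\<dots> = (\<Sum>j. ?H j) - (\<Sum>j. if j \<in> {..<K} then ?H j else 0)"
        by (intro suminf_diff[symmetric] sH) (auto intro: summable_finite[of "{..<K}"])
      also have "(\<Sum>j. if j \<in> {..<K} then ?H j else 0) = (\<Sum>j<K. ?H j)"
        by (subst suminf_finite[of "{..<K}"]) auto
      finally show ?thesis .
    qed
    have "(\<lambda>K. (\<Sum>j. ?H j) - (\<Sum>j<K. ?H j)) \<longlonglongrightarrow> (\<Sum>j. ?H j) - (\<Sum>j. ?H j)"
      by (intro tendsto_intros summable_LIMSEQ sH)
    then have "(\<lambda>K. (\<Sum>j. ?H j) - (\<Sum>j<K. ?H j)) \<longlonglongrightarrow> 0" by simp
    then have "(\<lambda>K. avg (- int K) (X 0) \<omega>) \<longlonglongrightarrow> 0"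
      by (rule Lim_null_comparison[rotated]) (use elim(1) tail in auto)
    then have "(\<lambda>K. X 0 \<omega> - avg (- int K) (X 0) \<omega>) \<longlonglongrightarrow> X 0 \<omega> - 0"
      by (intro tendsto_intros)
    then show ?case unfolding sums_def part by simp
  qed
qed

lemma X_sums: "AE \<omega> in P. (\<lambda>k. \<xi> k (i - int k) \<omega>) sums X i \<omega>"
proof -
  have "shift a (shift i \<omega>) = shift (i + a) \<omega>" for a and \<omega> :: "int \<Rightarrow> 'a"
    by (simp add: shift_def fun_eq_iff algebra_simps)
  then have *: "\<xi> k a (shift i \<omega>) = \<xi> k (i + a) \<omega>" for k a \<omega>
    by (simp add: \<xi>_def)
  show ?thesis using AE_shift[OF X0_sums, of i] by (simp add: * X_shift)
qed

text \<open>
  The bound \<open>H k\<close> depends on a coordinate that is independent of \<open>A\<close>, hence the factor \<open>P(A)\<close>.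
\<close>
lemma nn_\<xi>:
  assumes "A \<in> sets (past M l)" "l < a"
  shows "(\<integral>\<^sup>+\<omega>. indicator A \<omega> * ennreal ((\<xi> k a \<omega>)\<^sup>2) \<partial>P) \<le> emeasure P A * ennreal ((c k)\<^sup>2)"
proof -
  have "(\<integral>\<^sup>+\<omega>. indicator A \<omega> * ennreal ((\<xi> k a \<omega>)\<^sup>2) \<partial>P) \<le> (\<integral>\<^sup>+\<omega>. indicator A \<omega> * ennreal ((H k (\<omega> a))\<^sup>2) \<partial>P)"
  proof (rule nn_integral_mono_AE)
    show "AE \<omega> in P. indicator A \<omega> * ennreal ((\<xi> k a \<omega>)\<^sup>2) \<le> indicator A \<omega> * ennreal ((H k (\<omega> a))\<^sup>2)"
      using \<xi>_bound[of k a]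
      by eventually_elim (intro mult_left_mono ennreal_leI, auto dest: power_mono[of "\<bar>_\<bar>" _ 2])
  qed
  also have "\<dots> = emeasure P A * (\<integral>\<^sup>+x. ennreal ((H k x)\<^sup>2) \<partial>M)"
    using nn_integral_past_coord[OF assms, of "\<lambda>x. ennreal ((H k x)\<^sup>2)"] by simp
  also have "\<dots> \<le> emeasure P A * ennreal ((c k)\<^sup>2)" by (intro mult_left_mono nn_H) simp
  finally show ?thesis .
qed

lemma nn_\<xi>': "(\<integral>\<^sup>+\<omega>. ennreal ((\<xi> k a \<omega>)\<^sup>2) \<partial>P) \<le> ennreal ((c k)\<^sup>2)"
proof -
  have "(\<integral>\<^sup>+\<omega>. ennreal ((\<xi> k a \<omega>)\<^sup>2) \<partial>P) = (\<integral>\<^sup>+\<omega>. indicator (space P) \<omega> * ennreal ((\<xi> k a \<omega>)\<^sup>2) \<partial>P)"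
    by (intro nn_integral_cong) auto
  also have "\<dots> \<le> ennreal ((c k)\<^sup>2)"
    using nn_\<xi>[of "space P" "a - 1" a k] sets.top[of "past M (a - 1)"] by (simp add: path.emeasure_space_1)
  finally show ?thesis .
qed

lemma \<xi>_square: "integrable P (\<lambda>\<omega>. (\<xi> k a \<omega>)\<^sup>2)"
  by (rule integrable_of_nn_integral[OF _ nn_\<xi>']) auto

lemma \<xi>_orth:
  assumes G: "G \<in> borel_measurable (past M l)" "integrable P (\<lambda>\<omega>. (G \<omega>)\<^sup>2)" and l: "l < a"
  shows "(\<integral>\<omega>. G \<omega> * \<xi> k a \<omega> \<partial>P) = 0"
proof -
  let ?X = "X (int k + a)"
  have GP: "G \<in> borel_measurable P" using G past_path by auto
  have i: "integrable P (\<lambda>\<omega>. G \<omega> * ?X \<omega>)"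
    by (rule integrable_mult_of_squares[OF GP _ G(2) X_square]) simp
  have G': "G \<in> borel_measurable (past M a)" "G \<in> borel_measurable (past M (a - 1))"
    using G(1) l past_mono[of l a] past_mono[of l "a - 1"] by (auto simp: subset_iff)
  have "(\<integral>\<omega>. G \<omega> * \<xi> k a \<omega> \<partial>P) = (\<integral>\<omega>. G \<omega> * avg a ?X \<omega> - G \<omega> * avg (a - 1) ?X \<omega> \<partial>P)"
    by (rule Bochner_Integration.integral_cong) (auto simp: \<xi>_eq algebra_simps)
  also have "\<dots> = 0"
    using integral_mult_avg[OF G'(1) i] integral_mult_avg[OF G'(2) i] by simp
  finally show ?thesis .
qed

text \<open>
  Doob's inequality for the martingale \<open>n \<mapsto> \<Sum>\<^sub>i\<^sub><\<^sub>n \<xi> k (a + i + 1)\<close>, whose increments start just after time \<open>a\<close>.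
\<close>
lemma Doob_\<xi>:
  assumes A: "A \<in> sets (past M a)"
  shows "(\<integral>\<^sup>+\<omega>. indicator A \<omega> * ennreal ((running_max (\<lambda>n. \<Sum>i<n. \<xi> k (a + int i + 1) \<omega>) N)\<^sup>2) \<partial>P)
    \<le> ennreal (4 * real N * (path.prob A * (c k)\<^sup>2))"
proof (rule Doob_L2[where F = "\<lambda>i. past M (a + int i)"])
  show "subalgebra (past M (a + int (Suc i))) (past M (a + int i))" for i
    by (rule subalgebra_past_mono) simp
  show "(\<integral>\<^sup>+\<omega>. indicator A \<omega> * ennreal ((\<xi> k (a + int i + 1) \<omega>)\<^sup>2) \<partial>P) \<le> ennreal (path.prob A * (c k)\<^sup>2)" for i
    using nn_\<xi>[OF A, of "a + int i + 1" k] by (simp add: path.emeasure_eq_measure ennreal_mult)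
qed (use A in \<open>auto intro!: subalgebra_past \<xi>_past \<xi>_square \<xi>_orth\<close>)

definition D :: "(int \<Rightarrow> 'a) \<Rightarrow> real" where "D \<omega> = (\<Sum>k. d k \<omega>)"

section \<open>Past and future parts of the martingale error\<close>

text \<open>
  For the lag \<open>k\<close>, \<open>mart k\<close> is the martingale of the increments at the times \<open>1, 2, \<dots>\<close>, \<open>future_max\<close> is the largest of its
  increments (in modulus) over at most \<open>k\<close> steps, and \<open>past_max\<close> the largest modulus of the sums of the increments at the times \<open>-k+1, \<dots>, 0\<close>. The family \<open>known_part\<close> is
  indexed from \<open>0\<close>: \<open>known_part i\<close> is \<open>E(X\<^sub>i\<^sub>+\<^sub>1 | \<F>\<^sub>0)\<close>.
\<close>
definition mart :: "nat \<Rightarrow> nat \<Rightarrow> (int \<Rightarrow> 'a) \<Rightarrow> real" where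
  "mart k n \<omega> = (\<Sum>i<n. \<xi> k (int i + 1) \<omega>)"

definition future_max :: "nat \<Rightarrow> nat \<Rightarrow> (int \<Rightarrow> 'a) \<Rightarrow> real" where
  "future_max k N \<omega> = running_max (\<lambda>n. mart k n \<omega> - mart k (n - k) \<omega>) N"

definition past_max :: "nat \<Rightarrow> nat \<Rightarrow> (int \<Rightarrow> 'a) \<Rightarrow> real" where
  "past_max k N \<omega> = running_max (\<lambda>n. \<Sum>i<n. \<xi> k (- int k + int i + 1) \<omega>) (min N k)"

definition known_part :: "nat \<Rightarrow> (int \<Rightarrow> 'a) \<Rightarrow> real" where
  "known_part i \<omega> = (\<Sum>k. if i < k then \<xi> k (- int k + int i + 1) \<omega> else 0)"

lemma mart_measurable[measurable]: "mart k n \<in> borel_measurable P"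
  unfolding mart_def[abs_def] by measurable

lemma future_max_measurable[measurable]: "future_max k N \<in> borel_measurable P"
  unfolding future_max_def[abs_def] by (intro running_max_measurable) auto

lemma past_max_measurable[measurable]: "past_max k N \<in> borel_measurable P"
  unfolding past_max_def[abs_def] by (intro running_max_measurable) auto

lemma future_max_nonneg[simp]: "0 \<le> future_max k N \<omega>" by (simp add: future_max_def)
lemma past_max_nonneg[simp]: "0 \<le> past_max k N \<omega>" by (simp add: past_max_def)

lemma known_part_past: "known_part i \<in> borel_measurable (past M 0)"
proof -
  have "(\<lambda>\<omega>. if i < k then \<xi> k (- int k + int i + 1) \<omega> else 0) \<in> borel_measurable (past M 0)" for k
    by (cases "i < k") (auto intro!: \<xi>_past)
  then show ?thesis unfolding known_part_def[abs_def] by (rule borel_measurable_suminf)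
qed

lemma known_part_measurable[measurable]: "known_part i \<in> borel_measurable P"
  using known_part_past past_path by auto

lemma D_past: "D \<in> borel_measurable (past M 0)"
  unfolding D_def[abs_def] using d_past by (rule borel_measurable_suminf)

lemma D_measurable[measurable]: "D \<in> borel_measurable P"
  using D_past past_path by auto

lemma D_shift: "D (shift i \<omega>) = (\<Sum>k. \<xi> k i \<omega>)"
  by (simp add: D_def \<xi>_def)

lemma AE_summable_\<xi>: "AE \<omega> in P. summable (\<lambda>k. \<xi> k (\<kappa> k) \<omega>)"
proof -
  have "AE \<omega> in P. \<forall>k. \<bar>\<xi> k (\<kappa> k) \<omega>\<bar> \<le> H k (\<omega> (\<kappa> k))"
    using \<xi>_bound by (simp add: AE_all_countable)
  then show ?thesis using AE_summable_h[of \<kappa>]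
    by eventually_elim (rule summable_comparison_test'[OF summable_H], auto)
qed

text \<open>
  For each lag \<open>k\<close>, the increments in \<open>X\<^sub>1 + \<dots> + X\<^sub>n\<close> at times after \<open>0\<close> are those at \<open>1, \<dots>, n - k\<close> (natural subtraction), while
  the martingale uses the times \<open>1, \<dots>, n\<close>. The increments at times up to \<open>0\<close> make up the known parts. Absolute convergence
  in \<open>k\<close> allows the sums to be rearranged.
\<close>
lemma mart_error_eq:
  "AE \<omega> in P. \<forall>n. mart_error X D n \<omega> = (\<Sum>i<n. known_part i \<omega>) - (\<Sum>k. mart k n \<omega> - mart k (n - k) \<omega>) \<and>
     (\<Sum>i<n. known_part i \<omega>) = (\<Sum>k. \<Sum>i<min n k. \<xi> k (- int k + int i + 1) \<omega>)"
proof -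
  have 1: "AE \<omega> in P. \<forall>i::nat. (\<lambda>k. \<xi> k (int i + 1 - int k) \<omega>) sums X (int i + 1) \<omega>"
    using X_sums by (simp add: AE_all_countable)
  have 2: "AE \<omega> in P. \<forall>i::nat. summable (\<lambda>k. \<xi> k (int i + 1) \<omega>)"
    using AE_summable_\<xi> by (simp add: AE_all_countable)
  have 3: "AE \<omega> in P. \<forall>i::nat. summable (\<lambda>k. \<xi> k (- int k + int i + 1) \<omega>)"
    using AE_summable_\<xi> by (simp add: AE_all_countable)
  show ?thesis using 1 2 3
  proof eventually_elim
    case (elim \<omega>)
    let ?y = "\<lambda>i k. \<xi> k (int i + 1) \<omega>"
    let ?x = "\<lambda>i k. \<xi> k (- int k + int i + 1) \<omega>"
    note sx = elim(3)[rule_format] and sy = elim(2)[rule_format]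
    \<comment> \<open>Dropping finitely many terms from a summable series.\<close>
    have tail: "summable (\<lambda>k. if i < k then ?x i k else 0)" for i
    proof -
      have "summable (\<lambda>k. ?x i k - (if k \<in> {..i} then ?x i k else 0))"
        by (intro summable_diff sx summable_finite[of "{..i}"]) auto
      also have "(\<lambda>k. ?x i k - (if k \<in> {..i} then ?x i k else 0)) = (\<lambda>k. if i < k then ?x i k else 0)"
        by auto
      finally show ?thesis .
    qed
    have head: "summable (\<lambda>k. if k \<le> i then ?x i k else 0)" for i
      by (rule summable_finite[of "{..i}"]) auto
    have X: "X (int i + 1) \<omega> = known_part i \<omega> + (\<Sum>k. if k \<le> i then ?x i k else 0)" for i
    proof -
      have "X (int i + 1) \<omega> = (\<Sum>k. ?x i k)"
        using sums_unique[OF elim(1)[rule_format, of i]] by (simp add: algebra_simps)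
      also have "\<dots> = (\<Sum>k. (if i < k then ?x i k else 0) + (if k \<le> i then ?x i k else 0))"
        by (intro suminf_cong) auto
      also have "\<dots> = known_part i \<omega> + (\<Sum>k. if k \<le> i then ?x i k else 0)"
        unfolding known_part_def by (rule suminf_add[OF tail head, symmetric])
      finally show ?thesis .
    qed
    show ?case
    proof (intro allI conjI)
      fix n
      have "mart_error X D n \<omega> = (\<Sum>i<n. X (int i + 1) \<omega>) - (\<Sum>i<n. D (shift (int i + 1) \<omega>))"
        unfolding mart_error_def One_nat_def sum.atLeast1_atMost_eq by (simp add: algebra_simps)
      also have "\<dots> = (\<Sum>i<n. known_part i \<omega>) - (\<Sum>i<n. (\<Sum>k. ?y i k) - (\<Sum>k. if k \<le> i then ?x i k else 0))"
        by (simp add: X D_shift sum.distrib sum_subtractf)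
      also have "(\<Sum>i<n. (\<Sum>k. ?y i k) - (\<Sum>k. if k \<le> i then ?x i k else 0))
          = (\<Sum>i<n. \<Sum>k. ?y i k - (if k \<le> i then ?x i k else 0))"
        by (intro sum.cong refl suminf_diff sy head)
      also have "\<dots> = (\<Sum>k. \<Sum>i<n. ?y i k - (if k \<le> i then ?x i k else 0))"
        by (intro suminf_sum[symmetric] summable_diff sy head)
      also have "\<dots> = (\<Sum>k. mart k n \<omega> - mart k (n - k) \<omega>)"
      proof (intro suminf_cong)
        fix k
        have "(\<Sum>i<n. if k \<le> i then ?x i k else 0) = (\<Sum>i<n. if k \<le> i then \<xi> k (int (i - k) + 1) \<omega> else 0)"
          by (intro sum.cong refl) (auto simp: algebra_simps of_nat_diff)
        also have "\<dots> = mart k (n - k) \<omega>" unfolding mart_def by (rule sum_delayed)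
        finally show "(\<Sum>i<n. ?y i k - (if k \<le> i then ?x i k else 0)) = mart k n \<omega> - mart k (n - k) \<omega>"
          by (simp add: sum_subtractf mart_def)
      qed
      finally show "mart_error X D n \<omega> = (\<Sum>i<n. known_part i \<omega>) - (\<Sum>k. mart k n \<omega> - mart k (n - k) \<omega>)" .
      have "(\<Sum>i<n. known_part i \<omega>) = (\<Sum>k. \<Sum>i<n. if i < k then ?x i k else 0)"
        unfolding known_part_def by (intro suminf_sum[symmetric] tail)
      then show "(\<Sum>i<n. known_part i \<omega>) = (\<Sum>k. \<Sum>i<min n k. ?x i k)" by (simp add: sum_before)
    qed
  qed
qed

lemma future_part_le:
  assumes "n \<le> N"
  shows "ennreal \<bar>\<Sum>k. mart k n \<omega> - mart k (n - k) \<omega>\<bar> \<le> (\<Sum>k. ennreal (future_max k N \<omega>))"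
  by (rule ennreal_abs_suminf_le)
    (unfold future_max_def, rule abs_le_running_max[of n N "\<lambda>n. mart _ n \<omega> - mart _ (n - _) \<omega>"], rule assms)

lemma past_part_le:
  assumes "n \<le> N"
  shows "ennreal \<bar>\<Sum>k. \<Sum>i<min n k. \<xi> k (- int k + int i + 1) \<omega>\<bar> \<le> (\<Sum>k. ennreal (past_max k N \<omega>))"
  by (rule ennreal_abs_suminf_le)
    (unfold past_max_def, rule abs_le_running_max[of "min n _" "min N _" "\<lambda>n. \<Sum>i<n. \<xi> _ (- int _ + int i + 1) \<omega>"],
      use assms in auto)

section \<open>Maximal inequality for the future part\<close>

text \<open>
  \<open>future_rate k N\<close> bounds the \<open>L\<^sup>2\<close> norm of \<open>future_max k N\<close> divided by \<open>\<surd>N\<close>. The first entry of the minimum comes from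
  Doob's inequality and is summable in \<open>k\<close>. The second comes from bounding \<open>k\<close> consecutive increments by \<open>k\<close> times the largest;
  it tends to \<open>0\<close> for fixed \<open>k\<close>.
\<close>
definition tail_moment :: "nat \<Rightarrow> nat \<Rightarrow> real" where
  "tail_moment k N = (\<integral>x. (H k x)\<^sup>2 * indicator {x. sqrt (real N) < (H k x)\<^sup>2} x \<partial>M)"

definition future_rate :: "nat \<Rightarrow> nat \<Rightarrow> real" where
  "future_rate k N = min (4 * c k) (real k * sqrt (1 / sqrt (real N) + tail_moment k N))"

lemma integrable_H2: "integrable M (\<lambda>x. (H k x)\<^sup>2)"
  by (rule integrable_of_nn_integral[OF _ nn_H]) auto

lemma tail_moment_nonneg[simp]: "0 \<le> tail_moment k N" unfolding tail_moment_def by (intro Bochner_Integration.integral_nonneg) auto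

lemma future_rate_nonneg[simp]: "0 \<le> future_rate k N" unfolding future_rate_def by simp

lemma tail_moment_tendsto: "(\<lambda>N. tail_moment k N) \<longlonglongrightarrow> 0"
proof -
  have "(\<lambda>N. tail_moment k N) \<longlonglongrightarrow> (\<integral>x. 0 \<partial>M)"
    unfolding tail_moment_def
  proof (rule integral_dominated_convergence[where w = "\<lambda>x. (H k x)\<^sup>2"])
    show "AE x in M. (\<lambda>N. (H k x)\<^sup>2 * indicator {x. sqrt (real N) < (H k x)\<^sup>2} x) \<longlonglongrightarrow> 0"
    proof (rule AE_I2)
      fix x
      have "filterlim (\<lambda>N. sqrt (real N)) at_top sequentially"
        by (intro filterlim_compose[OF sqrt_at_top] filterlim_real_sequentially)
      then have "eventually (\<lambda>N. (H k x)\<^sup>2 \<le> sqrt (real N)) sequentially"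
        by (simp add: filterlim_at_top)
      then have "eventually (\<lambda>N. (H k x)\<^sup>2 * indicator {x. sqrt (real N) < (H k x)\<^sup>2} x = 0) sequentially"
        by eventually_elim auto
      then show "(\<lambda>N. (H k x)\<^sup>2 * indicator {x. sqrt (real N) < (H k x)\<^sup>2} x) \<longlonglongrightarrow> 0"
        by (rule tendsto_eventually)
    qed
    show "AE x in M. norm ((H k x)\<^sup>2 * indicator {x. sqrt (real N) < (H k x)\<^sup>2} x) \<le> (H k x)\<^sup>2" for N
      by (auto simp: indicator_def)
  qed (auto intro: integrable_H2)
  then show ?thesis by simp
qed

lemma future_rate_tendsto: "(\<lambda>N. future_rate k N) \<longlonglongrightarrow> 0"
proof -
  have "(\<lambda>N. 1 / sqrt (real N)) \<longlonglongrightarrow> 0"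
    by (intro tendsto_divide_0[OF tendsto_const] filterlim_at_top_imp_at_infinity
        filterlim_compose[OF sqrt_at_top] filterlim_real_sequentially)
  then have "(\<lambda>N. real k * sqrt (1 / sqrt (real N) + tail_moment k N)) \<longlonglongrightarrow> real k * sqrt (0 + 0)"
    by (intro tendsto_intros tail_moment_tendsto)
  then have *: "(\<lambda>N. real k * sqrt (1 / sqrt (real N) + tail_moment k N)) \<longlonglongrightarrow> 0" by simp
  show ?thesis
    by (rule tendsto_sandwich[OF _ _ tendsto_const *]) (auto simp: future_rate_def intro!: always_eventually)
qed

lemma summable_future_rate: "summable (\<lambda>k. future_rate k N)"
  by (rule summable_comparison_test'[OF summable_mult[OF summable_c, of 4]]) (auto simp: future_rate_def)

lemma suminf_future_rate_tendsto: "(\<lambda>N. \<Sum>k. future_rate k N) \<longlonglongrightarrow> 0"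
proof -
  have "eventually (\<lambda>(k, N). norm (future_rate k N) \<le> 4 * c k) (at_top \<times>\<^sub>F sequentially)"
    by (intro always_eventually) (auto simp: future_rate_def)
  from tannerys_theorem[OF future_rate_tendsto this summable_mult[OF summable_c]] show ?thesis by simp
qed

lemma future_max_le: "future_max k N \<omega> \<le> 2 * running_max (\<lambda>n. mart k n \<omega>) N"
  unfolding future_max_def
proof (rule running_max_le)
  fix n assume "n \<le> N"
  then have "n - k \<le> N" by simp
  with \<open>n \<le> N\<close> show "\<bar>mart k n \<omega> - mart k (n - k) \<omega>\<bar> \<le> 2 * running_max (\<lambda>n. mart k n \<omega>) N"
    using abs_le_running_max[of n N "\<lambda>n. mart k n \<omega>"] abs_le_running_max[of "n - k" N "\<lambda>n. mart k n \<omega>"]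
    by (simp add: abs_le_iff)
qed

text \<open>
  Of \<open>N\<close> nonnegative numbers, the largest is at most the level \<open>\<surd>N\<close> plus the sum of those above that level. The level has to grow more
  slowly than \<open>N\<close> but to infinity; any other such choice would do.
\<close>
lemma future_max_square_le:
  assumes b: "\<And>i::nat. \<bar>\<xi> k (int i + 1) \<omega>\<bar> \<le> H k (\<omega> (int i + 1))"
  shows "(future_max k N \<omega>)\<^sup>2 \<le> (real k)\<^sup>2 * (sqrt (real N) +
     (\<Sum>i<N. (H k (\<omega> (int i + 1)))\<^sup>2 * indicator {x. sqrt (real N) < (H k x)\<^sup>2} (\<omega> (int i + 1))))"
proof -
  let ?u = "\<lambda>x. (H k x)\<^sup>2 * indicator {x. sqrt (real N) < (H k x)\<^sup>2} x"
  define B where "B = sqrt (real N) + (\<Sum>i<N. ?u (\<omega> (int i + 1)))"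
  have B: "0 \<le> B" unfolding B_def by (intro add_nonneg_nonneg sum_nonneg) auto
  have H: "H k (\<omega> (int i + 1)) \<le> sqrt B" if "i < N" for i
  proof -
    have "(H k (\<omega> (int i + 1)))\<^sup>2 \<le> sqrt (real N) + ?u (\<omega> (int i + 1))"
      by (auto simp: indicator_def)
    also have "?u (\<omega> (int i + 1)) \<le> (\<Sum>i<N. ?u (\<omega> (int i + 1)))"
      using that by (intro member_le_sum) auto
    finally show ?thesis by (intro real_le_rsqrt) (simp add: B_def)
  qed
  have "future_max k N \<omega> \<le> real k * sqrt B"
    unfolding future_max_def
  proof (rule running_max_le)
    fix n assume n: "n \<le> N"
    have "mart k n \<omega> = mart k (n - k) \<omega> + (\<Sum>i=n-k..<n. \<xi> k (int i + 1) \<omega>)"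
      using sum.atLeastLessThan_concat[of 0 "n - k" n "\<lambda>i. \<xi> k (int i + 1) \<omega>"]
      by (simp add: mart_def atLeast0LessThan)
    then have "\<bar>mart k n \<omega> - mart k (n - k) \<omega>\<bar> = \<bar>\<Sum>i=n-k..<n. \<xi> k (int i + 1) \<omega>\<bar>" by simp
    also have "\<dots> \<le> (\<Sum>i=n-k..<n. \<bar>\<xi> k (int i + 1) \<omega>\<bar>)" by (rule sum_abs)
    also have "\<dots> \<le> (\<Sum>i=n-k..<n. sqrt B)"
      using n by (intro sum_mono order_trans[OF b H]) auto
    also have "\<dots> \<le> real k * sqrt B" using B by (auto intro!: mult_right_mono)
    finally show "\<bar>mart k n \<omega> - mart k (n - k) \<omega>\<bar> \<le> real k * sqrt B" .
  qed
  then have "(future_max k N \<omega>)\<^sup>2 \<le> (real k * sqrt B)\<^sup>2" by (rule power_mono) simp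
  then show ?thesis using B by (simp add: power_mult_distrib B_def)
qed

lemma nn_future_max:
  assumes A: "A \<in> sets (past M 0)" and N: "0 < N"
  shows "(\<integral>\<^sup>+\<omega>. indicator A \<omega> * ennreal ((future_max k N \<omega>)\<^sup>2) \<partial>P) \<le> ennreal (path.prob A * real N * (future_rate k N)\<^sup>2)"
proof -
  have [measurable]: "A \<in> sets P" using A subalgebra_past[of 0] by (auto simp: subalgebra_def)
  let ?I = "\<integral>\<^sup>+\<omega>. indicator A \<omega> * ennreal ((future_max k N \<omega>)\<^sup>2) \<partial>P"
  have 1: "?I \<le> ennreal (path.prob A * real N * (4 * c k)\<^sup>2)"
  proof -
    have "?I \<le> (\<integral>\<^sup>+\<omega>. 4 * (indicator A \<omega> * ennreal ((running_max (\<lambda>n. mart k n \<omega>) N)\<^sup>2)) \<partial>P)"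
    proof (rule nn_integral_mono)
      fix \<omega>
      have "(future_max k N \<omega>)\<^sup>2 \<le> (2 * running_max (\<lambda>n. mart k n \<omega>) N)\<^sup>2" by (intro power_mono future_max_le) simp
      then have "ennreal ((future_max k N \<omega>)\<^sup>2) \<le> 4 * ennreal ((running_max (\<lambda>n. mart k n \<omega>) N)\<^sup>2)"
        by (simp add: numeral_mult_ennreal ennreal_leI power_mult_distrib)
      then show "indicator A \<omega> * ennreal ((future_max k N \<omega>)\<^sup>2) \<le> 4 * (indicator A \<omega> * ennreal ((running_max (\<lambda>n. mart k n \<omega>) N)\<^sup>2))"
        by (auto simp: indicator_def)
    qed
    also have "\<dots> = 4 * (\<integral>\<^sup>+\<omega>. indicator A \<omega> * ennreal ((running_max (\<lambda>n. mart k n \<omega>) N)\<^sup>2) \<partial>P)"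
    proof -
      have [measurable]: "(\<lambda>\<omega>. running_max (\<lambda>n. mart k n \<omega>) N) \<in> borel_measurable P"
        by (intro running_max_measurable) auto
      show ?thesis by (intro nn_integral_cmult) auto
    qed
    also have "\<dots> \<le> 4 * ennreal (4 * real N * (path.prob A * (c k)\<^sup>2))"
      using Doob_\<xi>[OF A, of k N] by (intro mult_left_mono) (auto simp: mart_def)
    also have "\<dots> = ennreal (path.prob A * real N * (4 * c k)\<^sup>2)"
      by (simp add: numeral_mult_ennreal power_mult_distrib algebra_simps)
    finally show ?thesis .
  qed
  have 2: "?I \<le> ennreal (path.prob A * real N * (real k * sqrt (1 / sqrt (real N) + tail_moment k N))\<^sup>2)"
  proof -
    let ?u = "\<lambda>x. (H k x)\<^sup>2 * indicator {x. sqrt (real N) < (H k x)\<^sup>2} x"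
    have u[measurable]: "(\<lambda>x. ennreal (?u x)) \<in> borel_measurable M" by measurable
    have nu: "(\<integral>\<^sup>+x. ennreal (?u x) \<partial>M) = ennreal (tail_moment k N)"
      unfolding tail_moment_def
      by (intro nn_integral_eq_integral Bochner_Integration.integrable_bound[OF integrable_H2[of k]])
        (auto simp: indicator_def)
    \<comment> \<open>The \<open>i\<close>-th excess over the level depends on the coordinate \<open>i + 1 > 0\<close>, independent of \<open>A\<close>.\<close>
    define G where "G i \<omega> = indicator A \<omega> * ennreal (?u (\<omega> (int i + 1)))" for i :: nat and \<omega>
    have [measurable]: "G i \<in> borel_measurable P" for i unfolding G_def[abs_def] by measurable
    have nG: "(\<integral>\<^sup>+\<omega>. G i \<omega> \<partial>P) = emeasure P A * ennreal (tail_moment k N)" for i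
      unfolding G_def nu[symmetric] by (rule nn_integral_past_coord[OF A _ u]) simp
    have "AE \<omega> in P. \<forall>i::nat. \<bar>\<xi> k (int i + 1) \<omega>\<bar> \<le> H k (\<omega> (int i + 1))"
      using \<xi>_bound by (simp add: AE_all_countable)
    then have "AE \<omega> in P. indicator A \<omega> * ennreal ((future_max k N \<omega>)\<^sup>2) \<le>
       ennreal ((real k)\<^sup>2) * (ennreal (sqrt (real N)) * indicator A \<omega> + (\<Sum>i<N. G i \<omega>))"
    proof eventually_elim
      case (elim \<omega>)
      have "ennreal ((future_max k N \<omega>)\<^sup>2) \<le> ennreal ((real k)\<^sup>2 * (sqrt (real N) + (\<Sum>i<N. ?u (\<omega> (int i + 1)))))"
        by (intro ennreal_leI future_max_square_le elim[rule_format])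
      also have "\<dots> = ennreal ((real k)\<^sup>2) * (ennreal (sqrt (real N)) + (\<Sum>i<N. ennreal (?u (\<omega> (int i + 1)))))"
        by (subst ennreal_mult) (auto intro!: add_nonneg_nonneg sum_nonneg simp: ennreal_plus sum_nonneg sum_ennreal)
      finally show ?case by (auto simp: G_def indicator_def)
    qed
    then have "?I \<le> (\<integral>\<^sup>+\<omega>. ennreal ((real k)\<^sup>2) * (ennreal (sqrt (real N)) * indicator A \<omega>
        + (\<Sum>i<N. G i \<omega>)) \<partial>P)"
      by (rule nn_integral_mono_AE)
    also have "\<dots> = ennreal ((real k)\<^sup>2) * (ennreal (sqrt (real N)) * emeasure P A
        + (\<Sum>i<N. \<integral>\<^sup>+\<omega>. G i \<omega> \<partial>P))"
      by (simp add: nn_integral_cmult nn_integral_add nn_integral_sum)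
    also have "(\<Sum>i<N. \<integral>\<^sup>+\<omega>. G i \<omega> \<partial>P) = (\<Sum>i<N. emeasure P A * ennreal (tail_moment k N))"
      by (simp only: nG)
    also have "ennreal ((real k)\<^sup>2) * (ennreal (sqrt (real N)) * emeasure P A + (\<Sum>i<N. emeasure P A * ennreal (tail_moment k N)))
      = ennreal ((real k)\<^sup>2 * (sqrt (real N) * path.prob A + real N * (path.prob A * tail_moment k N)))"
      by (simp add: path.emeasure_eq_measure ennreal_mult ennreal_of_nat_eq_real_of_nat)
    also have "(real k)\<^sup>2 * (sqrt (real N) * path.prob A + real N * (path.prob A * tail_moment k N))
       = path.prob A * real N * (real k * sqrt (1 / sqrt (real N) + tail_moment k N))\<^sup>2"
    proof -
      have "sqrt (real N) = real N * (1 / sqrt (real N))" using N by (simp add: real_div_sqrt)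
      then have "sqrt (real N) * path.prob A = real N * (1 / sqrt (real N)) * path.prob A" by simp
      then show ?thesis by (simp add: power_mult_distrib algebra_simps)
    qed
    finally show ?thesis .
  qed
  show ?thesis using 1 2 unfolding future_rate_def min_def by auto
qed

definition future_error :: "nat \<Rightarrow> real" where "future_error N = (\<Sum>k. future_rate k N)"

lemma nn_future:
  assumes A: "A \<in> sets (past M 0)" and N: "0 < N"
  shows "(\<integral>\<^sup>+\<omega>. indicator A \<omega> * (\<Sum>k. ennreal (future_max k N \<omega>))\<^sup>2 \<partial>P) \<le> ennreal (path.prob A * real N * (future_error N)\<^sup>2)"
proof -
  have [measurable]: "A \<in> sets P" using A subalgebra_past[of 0] by (auto simp: subalgebra_def)
  have "(\<integral>\<^sup>+\<omega>. indicator A \<omega> * (\<Sum>k. ennreal (future_max k N \<omega>))\<^sup>2 \<partial>P)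
     = (\<integral>\<^sup>+\<omega>. (\<Sum>k. indicator A \<omega> * ennreal (future_max k N \<omega>))\<^sup>2 \<partial>P)"
    by (intro nn_integral_cong) (auto simp: indicator_def)
  also have "\<dots> \<le> ennreal ((\<Sum>k. sqrt (path.prob A * real N) * future_rate k N)\<^sup>2)"
  proof (rule nn_integral_suminf_square_le)
    fix k
    have "(\<integral>\<^sup>+\<omega>. (indicator A \<omega> * ennreal (future_max k N \<omega>))\<^sup>2 \<partial>P) = (\<integral>\<^sup>+\<omega>. indicator A \<omega> * ennreal ((future_max k N \<omega>)\<^sup>2) \<partial>P)"
      by (intro nn_integral_cong) (auto simp: indicator_def ennreal_power)
    then show "(\<integral>\<^sup>+\<omega>. (indicator A \<omega> * ennreal (future_max k N \<omega>))\<^sup>2 \<partial>P) \<le> ennreal ((sqrt (path.prob A * real N) * future_rate k N)\<^sup>2)"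
      using nn_future_max[OF A N, of k] by (simp add: power_mult_distrib)
  qed (auto intro: summable_mult summable_future_rate)
  also have "(\<Sum>k. sqrt (path.prob A * real N) * future_rate k N) = sqrt (path.prob A * real N) * future_error N"
    unfolding future_error_def by (rule suminf_mult[OF summable_future_rate])
  finally show ?thesis by (simp add: power_mult_distrib)
qed

section \<open>Maximal inequality for the past part\<close>

text \<open>
  Only \<open>min N k\<close> increments enter \<open>past_max k N\<close>, so Doob's inequality alone gives a rate that tends to \<open>0\<close> for fixed \<open>k\<close>.
\<close>
definition past_rate :: "nat \<Rightarrow> nat \<Rightarrow> real" where
  "past_rate k N = 2 * c k * sqrt (real (min N k) / real N)"

definition past_error :: "nat \<Rightarrow> real" where "past_error N = (\<Sum>k. past_rate k N)"

lemma past_rate_nonneg[simp]: "0 \<le> past_rate k N" by (simp add: past_rate_def)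

lemma past_rate_le: "past_rate k N \<le> 2 * c k"
proof -
  have "sqrt (real (min N k) / real N) \<le> 1" by (cases "N = 0") (auto simp: divide_le_eq)
  then show ?thesis unfolding past_rate_def by (intro mult_left_le) auto
qed

lemma past_rate_tendsto: "(\<lambda>N. past_rate k N) \<longlonglongrightarrow> 0"
proof -
  have "(\<lambda>N. real (min N k) / real N) \<longlonglongrightarrow> 0"
  proof (rule tendsto_sandwich[OF _ _ tendsto_const])
    show "(\<lambda>N. real k / real N) \<longlonglongrightarrow> 0" by (rule lim_const_over_n)
  qed (auto intro!: always_eventually divide_right_mono)
  then have "(\<lambda>N. past_rate k N) \<longlonglongrightarrow> 2 * c k * sqrt 0"
    unfolding past_rate_def by (intro tendsto_intros)
  then show ?thesis by simp
qed

lemma summable_past_rate: "summable (\<lambda>k. past_rate k N)"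
  by (rule summable_comparison_test'[OF summable_mult[OF summable_c, of 2]]) (auto simp: past_rate_le)

lemma past_error_tendsto: "past_error \<longlonglongrightarrow> 0"
proof -
  have "eventually (\<lambda>(k, N). norm (past_rate k N) \<le> 2 * c k) (at_top \<times>\<^sub>F sequentially)"
    by (intro always_eventually) (auto simp: past_rate_le)
  from tannerys_theorem[OF past_rate_tendsto this summable_mult[OF summable_c]] show ?thesis
    by (simp add: past_error_def[abs_def])
qed

lemma future_error_tendsto: "future_error \<longlonglongrightarrow> 0"
  using suminf_future_rate_tendsto by (simp add: future_error_def[abs_def])

lemma nn_past:
  assumes N: "0 < N"
  shows "(\<integral>\<^sup>+\<omega>. (\<Sum>k. ennreal (past_max k N \<omega>))\<^sup>2 \<partial>P) \<le> ennreal (real N * (past_error N)\<^sup>2)"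
proof -
  have "(\<integral>\<^sup>+\<omega>. (\<Sum>k. ennreal (past_max k N \<omega>))\<^sup>2 \<partial>P) \<le> ennreal ((\<Sum>k. sqrt (real N) * past_rate k N)\<^sup>2)"
  proof (rule nn_integral_suminf_square_le)
    fix k
    have "(\<integral>\<^sup>+\<omega>. (ennreal (past_max k N \<omega>))\<^sup>2 \<partial>P) = (\<integral>\<^sup>+\<omega>. indicator (space P) \<omega> * ennreal ((past_max k N \<omega>)\<^sup>2) \<partial>P)"
      by (intro nn_integral_cong) (auto simp: ennreal_power)
    also have "\<dots> \<le> ennreal (4 * real (min N k) * (c k)\<^sup>2)"
      using Doob_\<xi>[of "space P" "- int k" k "min N k"] sets.top[of "past M (- int k)"]
      by (simp add: past_max_def path.prob_space)
    also have "4 * real (min N k) * (c k)\<^sup>2 = (sqrt (real N) * past_rate k N)\<^sup>2"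
      using N by (simp add: past_rate_def power_mult_distrib)
    finally show "(\<integral>\<^sup>+\<omega>. (ennreal (past_max k N \<omega>))\<^sup>2 \<partial>P) \<le> ennreal ((sqrt (real N) * past_rate k N)\<^sup>2)" .
  qed (auto intro: summable_mult summable_past_rate)
  also have "(\<Sum>k. sqrt (real N) * past_rate k N) = sqrt (real N) * past_error N"
    unfolding past_error_def by (rule suminf_mult[OF summable_past_rate])
  finally show ?thesis by (simp add: power_mult_distrib)
qed

section \<open>Martingale approximation in the mean square\<close>
definition max_sq_error :: "nat \<Rightarrow> (int \<Rightarrow> 'a) \<Rightarrow> real" where
  "max_sq_error N \<omega> = Max ((\<lambda>k. (mart_error X D k \<omega>)\<^sup>2) ` {1..N})"

lemma mart_error_measurable[measurable]: "mart_error X D n \<in> borel_measurable P"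
  unfolding mart_error_def[abs_def]
  by (intro borel_measurable_diff borel_measurable_sum measurable_compose[OF shift_measurable]) auto

lemma max_sq_error_measurable[measurable]: "max_sq_error N \<in> borel_measurable P"
  unfolding max_sq_error_def[abs_def] by (intro borel_measurable_Max) auto

lemma max_sq_error_attained:
  assumes "0 < N"
  obtains k where "1 \<le> k" "k \<le> N" "max_sq_error N \<omega> = (mart_error X D k \<omega>)\<^sup>2"
proof -
  have "max_sq_error N \<omega> \<in> (\<lambda>k. (mart_error X D k \<omega>)\<^sup>2) ` {1..N}"
    unfolding max_sq_error_def using assms by (intro Max_in) auto
  then show ?thesis using that by auto
qed

lemma Max_abs_square:
  assumes "0 < N"
  shows "(Max ((\<lambda>k. \<bar>mart_error X D k \<omega>\<bar>) ` {1..N}))\<^sup>2 = max_sq_error N \<omega>"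
proof (rule antisym)
  obtain k where k: "k \<in> {1..N}" "Max ((\<lambda>k. \<bar>mart_error X D k \<omega>\<bar>) ` {1..N}) = \<bar>mart_error X D k \<omega>\<bar>"
  proof -
    have "Max ((\<lambda>k. \<bar>mart_error X D k \<omega>\<bar>) ` {1..N}) \<in> (\<lambda>k. \<bar>mart_error X D k \<omega>\<bar>) ` {1..N}"
      using assms by (intro Max_in) auto
    then show ?thesis using that by auto
  qed
  then show "(Max ((\<lambda>k. \<bar>mart_error X D k \<omega>\<bar>) ` {1..N}))\<^sup>2 \<le> max_sq_error N \<omega>"
    unfolding max_sq_error_def by (auto intro!: Max_ge)
  obtain j where j: "1 \<le> j" "j \<le> N" "max_sq_error N \<omega> = (mart_error X D j \<omega>)\<^sup>2" using max_sq_error_attained[OF assms] .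
  then have "\<bar>mart_error X D j \<omega>\<bar> \<le> Max ((\<lambda>k. \<bar>mart_error X D k \<omega>\<bar>) ` {1..N})"
    by (intro Max_ge) auto
  then show "max_sq_error N \<omega> \<le> (Max ((\<lambda>k. \<bar>mart_error X D k \<omega>\<bar>) ` {1..N}))\<^sup>2"
    using j power_mono[of "\<bar>mart_error X D j \<omega>\<bar>" _ 2] by simp
qed

lemma nn_max_sq_error:
  assumes N: "0 < N"
  shows "(\<integral>\<^sup>+\<omega>. ennreal (max_sq_error N \<omega>) \<partial>P) \<le> ennreal (real N * (2 * (past_error N)\<^sup>2 + 2 * (future_error N)\<^sup>2))"
proof -
  have "AE \<omega> in P. ennreal (max_sq_error N \<omega>) \<le> 2 * (\<Sum>k. ennreal (past_max k N \<omega>))\<^sup>2 + 2 * (\<Sum>k. ennreal (future_max k N \<omega>))\<^sup>2"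
    using mart_error_eq
  proof eventually_elim
    case (elim \<omega>)
    obtain n where n: "n \<le> N" "max_sq_error N \<omega> = (mart_error X D n \<omega>)\<^sup>2" using max_sq_error_attained[OF N] .
    show ?case unfolding n(2)
      using elim[rule_format, of n] past_part_le[OF n(1), of \<omega>] future_part_le[OF n(1), of \<omega>]
      by (intro square_diff_le[of _ "\<Sum>i<n. known_part i \<omega>" "\<Sum>k. mart k n \<omega> - mart k (n - k) \<omega>"]) auto
  qed
  then have "(\<integral>\<^sup>+\<omega>. ennreal (max_sq_error N \<omega>) \<partial>P)
    \<le> (\<integral>\<^sup>+\<omega>. 2 * (\<Sum>k. ennreal (past_max k N \<omega>))\<^sup>2 + 2 * (\<Sum>k. ennreal (future_max k N \<omega>))\<^sup>2 \<partial>P)"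
    by (rule nn_integral_mono_AE)
  also have "\<dots> = 2 * (\<integral>\<^sup>+\<omega>. (\<Sum>k. ennreal (past_max k N \<omega>))\<^sup>2 \<partial>P) + 2 * (\<integral>\<^sup>+\<omega>. (\<Sum>k. ennreal (future_max k N \<omega>))\<^sup>2 \<partial>P)"
    by (simp add: nn_integral_add nn_integral_cmult)
  also have "(\<integral>\<^sup>+\<omega>. (\<Sum>k. ennreal (future_max k N \<omega>))\<^sup>2 \<partial>P) = (\<integral>\<^sup>+\<omega>. indicator (space P) \<omega> * (\<Sum>k. ennreal (future_max k N \<omega>))\<^sup>2 \<partial>P)"
    by (intro nn_integral_cong) auto
  also have "2 * (\<integral>\<^sup>+\<omega>. (\<Sum>k. ennreal (past_max k N \<omega>))\<^sup>2 \<partial>P) + 2 * \<dots>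
     \<le> 2 * ennreal (real N * (past_error N)\<^sup>2) + 2 * ennreal (real N * (future_error N)\<^sup>2)"
  proof (intro add_mono mult_left_mono nn_past N)
    have "space P \<in> sets (past M 0)" using sets.top[of "past M 0"] by simp
    from nn_future[OF this N]
    show "(\<integral>\<^sup>+\<omega>. indicator (space P) \<omega> * (\<Sum>k. ennreal (future_max k N \<omega>))\<^sup>2 \<partial>P) \<le> ennreal (real N * (future_error N)\<^sup>2)"
      by (simp only: path.prob_space mult_1)
  qed simp_all
  also have "\<dots> = ennreal (real N * (2 * (past_error N)\<^sup>2 + 2 * (future_error N)\<^sup>2))"
    by (simp add: numeral_mult_ennreal algebra_simps flip: ennreal_plus)
  finally show ?thesis .
qed

lemma max_sq_error_tendsto: "(\<lambda>n. ennreal (1 / real n) * (\<integral>\<^sup>+\<omega>. ennreal (max_sq_error n \<omega>) \<partial>P)) \<longlonglongrightarrow> 0"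
proof (rule tendsto_sandwich[OF _ _ tendsto_const])
  show "eventually (\<lambda>n. ennreal (1 / real n) * (\<integral>\<^sup>+\<omega>. ennreal (max_sq_error n \<omega>) \<partial>P) \<le> ennreal (2 * (past_error n)\<^sup>2 + 2 * (future_error n)\<^sup>2)) sequentially"
    using eventually_gt_at_top[of 0]
  proof eventually_elim
    case (elim n)
    have "ennreal (1 / real n) * (\<integral>\<^sup>+\<omega>. ennreal (max_sq_error n \<omega>) \<partial>P)
       \<le> ennreal (1 / real n) * ennreal (real n * (2 * (past_error n)\<^sup>2 + 2 * (future_error n)\<^sup>2))"
      by (intro mult_left_mono nn_max_sq_error elim) simp
    also have "\<dots> = ennreal (2 * (past_error n)\<^sup>2 + 2 * (future_error n)\<^sup>2)"
      using elim by (simp add: ennreal_mult[symmetric])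
    finally show ?case .
  qed
  have "(\<lambda>n. ennreal (2 * (past_error n)\<^sup>2 + 2 * (future_error n)\<^sup>2)) \<longlonglongrightarrow> ennreal (2 * 0\<^sup>2 + 2 * 0\<^sup>2)"
    by (intro tendsto_ennrealI tendsto_intros past_error_tendsto future_error_tendsto)
  then show "(\<lambda>n. ennreal (2 * (past_error n)\<^sup>2 + 2 * (future_error n)\<^sup>2)) \<longlonglongrightarrow> 0" by simp
qed auto

text \<open>
  Used with \<open>n = 0\<close> for \<open>D \<in> L\<^sup>2\<close> and with \<open>n \<rightarrow> \<infinity>\<close> for the convergence of the series in \<open>L\<^sup>2\<close>.
\<close>
lemma D_tail_le:
  "L2_enorm P (\<lambda>\<omega>. (\<Sum>k<n. d k \<omega>) - D \<omega>) \<le> ennreal (\<Sum>k. c (k + n))"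
proof (rule L2_enorm_le)
  have "AE \<omega> in P. \<forall>k. \<bar>d k \<omega>\<bar> \<le> H k (\<omega> 0)"
    using d_bound by (simp add: AE_all_countable)
  then have "AE \<omega> in P. ennreal (((\<Sum>k<n. d k \<omega>) - D \<omega>)\<^sup>2) \<le> (\<Sum>k. ennreal (H (k + n) (\<omega> 0)))\<^sup>2"
    using AE_summable_h[of "\<lambda>_. 0"]
  proof eventually_elim
    case (elim \<omega>)
    have "summable (\<lambda>k. d k \<omega>)"
      by (rule summable_comparison_test'[OF summable_H[OF elim(2)]]) (use elim(1) in auto)
    then have "\<bar>(\<Sum>k<n. d k \<omega>) - D \<omega>\<bar> = \<bar>\<Sum>k. d (k + n) \<omega>\<bar>"
      using suminf_minus_initial_segment[of "\<lambda>k. d k \<omega>" n] by (simp add: D_def)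
    moreover have "ennreal \<bar>\<Sum>k. d (k + n) \<omega>\<bar> \<le> (\<Sum>k. ennreal (H (k + n) (\<omega> 0)))"
      using elim(1) by (intro ennreal_abs_suminf_le) auto
    ultimately have "(ennreal \<bar>(\<Sum>k<n. d k \<omega>) - D \<omega>\<bar>)\<^sup>2 \<le> (\<Sum>k. ennreal (H (k + n) (\<omega> 0)))\<^sup>2"
      by (intro power_mono) auto
    then show ?case by (simp add: ennreal_power)
  qed
  then have "(\<integral>\<^sup>+\<omega>. ennreal (((\<Sum>k<n. d k \<omega>) - D \<omega>)\<^sup>2) \<partial>P) \<le> (\<integral>\<^sup>+\<omega>. (\<Sum>k. ennreal (H (k + n) (\<omega> 0)))\<^sup>2 \<partial>P)"
    by (rule nn_integral_mono_AE)
  also have "\<dots> \<le> ennreal ((\<Sum>k. c (k + n))\<^sup>2)" by (rule nn_sum_H)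
  finally show "(\<integral>\<^sup>+\<omega>. ennreal (((\<Sum>k<n. d k \<omega>) - D \<omega>)\<^sup>2) \<partial>P) \<le> ennreal ((\<Sum>k. c (k + n))\<^sup>2)" .
qed (auto intro!: suminf_nonneg summable_ignore_initial_segment summable_c)

lemma D_L2_sums: "L2_sums P (\<lambda>k. P0 M (X (int k))) D"
  unfolding L2_sums_def
proof (rule tendsto_sandwich[OF _ _ tendsto_const])
  have "AE \<omega> in P. P0 M (X (int k)) \<omega> = d k \<omega>" for k
    using avg_eq_cond_exp[OF X_integrable, of 0 "int k"] avg_eq_cond_exp[OF X_integrable, of "-1" "int k"]
    by eventually_elim (simp add: P0_def d_def)
  then have "AE \<omega> in P. \<forall>k. P0 M (X (int k)) \<omega> = d k \<omega>" by (simp add: AE_all_countable)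
  then have "L2_enorm P (\<lambda>\<omega>. (\<Sum>k<n. P0 M (X (int k)) \<omega>) - D \<omega>) = L2_enorm P (\<lambda>\<omega>. (\<Sum>k<n. d k \<omega>) - D \<omega>)" for n
    by (intro L2_enorm_cong_AE) auto
  then show "eventually (\<lambda>n. L2_enorm P (\<lambda>\<omega>. (\<Sum>k<n. P0 M (X (int k)) \<omega>) - D \<omega>) \<le> ennreal (\<Sum>k. c (k + n))) sequentially"
    using D_tail_le by simp
  have "(\<lambda>n. (\<Sum>k. c k) - (\<Sum>k<n. c k)) \<longlonglongrightarrow> (\<Sum>k. c k) - (\<Sum>k. c k)"
    by (intro tendsto_intros summable_LIMSEQ summable_c)
  then have "(\<lambda>n. ennreal (\<Sum>k. c (k + n))) \<longlonglongrightarrow> ennreal 0"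
    by (intro tendsto_ennrealI) (simp add: suminf_minus_initial_segment summable_c)
  then show "(\<lambda>n. ennreal (\<Sum>k. c (k + n))) \<longlonglongrightarrow> 0" by simp
qed auto

text \<open>
  Each \<open>\<xi> k 1\<close> is orthogonal to the indicators of \<open>\<F>\<^sub>0\<close>; since the \<open>L\<^sup>1\<close> norms are summable, so is their sum \<open>D \<circ> T\<close>.
\<close>
lemma D_mart_diff: "mart_diff M D"
  unfolding mart_diff_def
proof (intro conjI D_past)
  show fin: "L2_enorm P D < \<top>"
  proof -
    have "L2_enorm P D = L2_enorm P (\<lambda>\<omega>. (\<Sum>k<0. d k \<omega>) - D \<omega>)" by (simp add: L2_enorm_def)
    also have "\<dots> < \<top>" using D_tail_le[of 0] ennreal_less_top by (rule le_less_trans)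
    finally show ?thesis .
  qed
  have abs_le: "(\<integral>\<omega>. \<bar>I \<omega> * \<xi> k 1 \<omega>\<bar> \<partial>P) \<le> c k" "integrable P (\<lambda>\<omega>. I \<omega> * \<xi> k 1 \<omega>)"
    if [measurable]: "I \<in> borel_measurable P" and I: "\<And>\<omega>. \<bar>I \<omega>\<bar> \<le> 1" for k and I :: "_ \<Rightarrow> real"
  proof -
    have i: "integrable P (\<xi> k 1)" by (rule path.integrable_of_square[OF _ \<xi>_square]) simp
    have le: "\<bar>I \<omega> * \<xi> k 1 \<omega>\<bar> \<le> \<bar>\<xi> k 1 \<omega>\<bar>" for \<omega>
      using I[of \<omega>] mult_right_mono[of "\<bar>I \<omega>\<bar>" 1 "\<bar>\<xi> k 1 \<omega>\<bar>"] by (simp add: abs_mult)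
    show int: "integrable P (\<lambda>\<omega>. I \<omega> * \<xi> k 1 \<omega>)"
      by (rule Bochner_Integration.integrable_bound[OF i]) (use le in auto)
    have "(\<integral>\<omega>. \<bar>I \<omega> * \<xi> k 1 \<omega>\<bar> \<partial>P) \<le> (\<integral>\<omega>. \<bar>\<xi> k 1 \<omega>\<bar> \<partial>P)"
      using int i le by (intro integral_mono) auto
    also have "(\<integral>\<omega>. \<bar>\<xi> k 1 \<omega>\<bar> \<partial>P) \<le> c k"
    proof (rule power2_le_imp_le)
      have "(\<integral>\<omega>. \<bar>\<xi> k 1 \<omega>\<bar> \<partial>P)\<^sup>2 \<le> (\<integral>\<omega>. (\<xi> k 1 \<omega>)\<^sup>2 \<partial>P)"
        using path.variance_eq[of "\<lambda>\<omega>. \<bar>\<xi> k 1 \<omega>\<bar>"] path.variance_positive[of "\<lambda>\<omega>. \<bar>\<xi> k 1 \<omega>\<bar>"] i \<xi>_square[of k 1] by simp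
      also have "\<dots> \<le> (c k)\<^sup>2"
      proof -
        have "ennreal (\<integral>\<omega>. (\<xi> k 1 \<omega>)\<^sup>2 \<partial>P) = (\<integral>\<^sup>+\<omega>. ennreal ((\<xi> k 1 \<omega>)\<^sup>2) \<partial>P)"
          using \<xi>_square by (intro nn_integral_eq_integral[symmetric]) auto
        also have "\<dots> \<le> ennreal ((c k)\<^sup>2)" by (rule nn_\<xi>')
        finally show ?thesis by simp
      qed
      finally show "(\<integral>\<omega>. \<bar>\<xi> k 1 \<omega>\<bar> \<partial>P)\<^sup>2 \<le> (c k)\<^sup>2" .
    qed simp
    finally show "(\<integral>\<omega>. \<bar>I \<omega> * \<xi> k 1 \<omega>\<bar> \<partial>P) \<le> c k" .
  qed
  have zero: "(\<integral>\<omega>. (\<Sum>k. I \<omega> * \<xi> k 1 \<omega>) \<partial>P) = (\<Sum>k. \<integral>\<omega>. I \<omega> * \<xi> k 1 \<omega> \<partial>P)"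
    "integrable P (\<lambda>\<omega>. \<Sum>k. I \<omega> * \<xi> k 1 \<omega>)"
    if [measurable]: "I \<in> borel_measurable P" and I: "\<And>\<omega>. \<bar>I \<omega>\<bar> \<le> 1" for I :: "_ \<Rightarrow> real"
  proof -
    have "AE \<omega> in P. \<forall>k. \<bar>\<xi> k 1 \<omega>\<bar> \<le> H k (\<omega> 1)" using \<xi>_bound by (simp add: AE_all_countable)
    then have s1: "AE \<omega> in P. summable (\<lambda>k. norm (I \<omega> * \<xi> k 1 \<omega>))" using AE_summable_h[of "\<lambda>_. 1"]
    proof eventually_elim
      case (elim \<omega>)
      have "\<bar>I \<omega> * \<xi> k 1 \<omega>\<bar> \<le> H k (\<omega> 1)" for k
        using I[of \<omega>] mult_mono[of "\<bar>I \<omega>\<bar>" 1 "\<bar>\<xi> k 1 \<omega>\<bar>" "H k (\<omega> 1)"] elim(1) by (simp add: abs_mult)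
      then show ?case by (intro summable_comparison_test'[OF summable_H[OF elim(2)]]) auto
    qed
    have s2: "summable (\<lambda>k. \<integral>\<omega>. norm (I \<omega> * \<xi> k 1 \<omega>) \<partial>P)"
      by (rule summable_comparison_test'[OF summable_c]) (use abs_le(1)[OF that] in \<open>auto simp: integral_nonneg\<close>)
    show "(\<integral>\<omega>. (\<Sum>k. I \<omega> * \<xi> k 1 \<omega>) \<partial>P) = (\<Sum>k. \<integral>\<omega>. I \<omega> * \<xi> k 1 \<omega> \<partial>P)"
      by (rule integral_suminf[OF abs_le(2)[OF that] s1 s2])
    show "integrable P (\<lambda>\<omega>. \<Sum>k. I \<omega> * \<xi> k 1 \<omega>)"
      by (rule integrable_suminf[OF abs_le(2)[OF that] s1 s2])
  qed
  show "AE \<omega> in P. real_cond_exp P (past M 0) (\<lambda>\<omega>'. D (shift 1 \<omega>')) \<omega> = 0"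
  proof (rule past.real_cond_exp_charact)
    show "integrable P (\<lambda>\<omega>'. D (shift 1 \<omega>'))"
      using zero(2)[of "\<lambda>_. 1"] by (simp add: D_shift)
    fix A assume A: "A \<in> sets (past M 0)"
    then have [measurable]: "A \<in> sets P" using subalgebra_past[of 0] by (auto simp: subalgebra_def)
    have sc: "(\<Sum>k. indicator A \<omega> * \<xi> k 1 \<omega>) = indicator A \<omega> * (\<Sum>k. \<xi> k 1 \<omega>)" for \<omega>
      by (auto simp: indicator_def)
    have "(\<integral>\<omega>. indicator A \<omega> * \<xi> k 1 \<omega> \<partial>P) = 0" for k
    proof (rule \<xi>_orth[of _ 0])
      have "(\<lambda>\<omega>. (indicator A \<omega> :: real)\<^sup>2) = indicator A" by (auto simp: indicator_def)
      then show "integrable P (\<lambda>\<omega>. (indicator A \<omega> :: real)\<^sup>2)" by (simp add: path.emeasure_eq_measure)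
    qed (use A in auto)
    then have "(\<integral>\<omega>. (\<Sum>k. indicator A \<omega> * \<xi> k 1 \<omega>) \<partial>P) = 0"
      by (subst zero(1)) (auto simp: indicator_def)
    then have "(\<integral>\<omega>. indicator A \<omega> * (\<Sum>k. \<xi> k 1 \<omega>) \<partial>P) = 0" unfolding sc .
    then show "(\<integral>\<omega>\<in>A. D (shift 1 \<omega>) \<partial>P) = (\<integral>\<omega>\<in>A. 0 \<partial>P)"
      by (simp add: set_lebesgue_integral_def D_shift)
  qed auto
qed

lemma D_L2_MMA: "L2_MMA_with M X D"
  unfolding L2_MMA_with_def L2_enorm_square
proof (intro conjI D_mart_diff)
  show "(\<lambda>n. ennreal (1 / real n) * (\<integral>\<^sup>+\<omega>. ennreal ((Max ((\<lambda>k. \<bar>mart_error X D k \<omega>\<bar>) ` {1..n}))\<^sup>2) \<partial>P)) \<longlonglongrightarrow> 0"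
  proof (rule Lim_transform_eventually[OF max_sq_error_tendsto])
    show "eventually (\<lambda>n. ennreal (1 / real n) * (\<integral>\<^sup>+\<omega>. ennreal (max_sq_error n \<omega>) \<partial>P) =
      ennreal (1 / real n) * (\<integral>\<^sup>+\<omega>. ennreal ((Max ((\<lambda>k. \<bar>mart_error X D k \<omega>\<bar>) ` {1..n}))\<^sup>2) \<partial>P)) sequentially"
      using eventually_gt_at_top[of 0] by eventually_elim (simp only: Max_abs_square)
  qed
qed

section \<open>Quenched martingale approximation\<close>

text \<open>
  The increments at different times are orthogonal, so the partial sums over the lags satisfy the bound by Pythagoras, and the
  limit does by Fatou's lemma.
\<close>
lemma nn_known_part: "(\<integral>\<^sup>+\<omega>. ennreal ((known_part i \<omega>)\<^sup>2) \<partial>P) \<le> (\<Sum>k. ennreal (if i < k then (c k)\<^sup>2 else 0))"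
proof -
  define z where "z k \<omega> = (if i < k then \<xi> k (- int k + int i + 1) \<omega> else 0)" for k \<omega>
  define t where "t K \<omega> = (\<Sum>k<K. z k \<omega>)" for K \<omega>
  have [measurable]: "z k \<in> borel_measurable P" for k unfolding z_def[abs_def] by (cases "i < k") auto
  have [measurable]: "t K \<in> borel_measurable P" for K unfolding t_def[abs_def] by measurable
  have z2: "integrable P (\<lambda>\<omega>. (z k \<omega>)\<^sup>2)" for k unfolding z_def by (cases "i < k") (auto simp: \<xi>_square)
  have zz: "integrable P (\<lambda>\<omega>. z k \<omega> * z l \<omega>)" for k l
    by (intro integrable_mult_of_squares z2) auto
  have orth: "(\<integral>\<omega>. z K \<omega> * z k \<omega> \<partial>P) = 0" if "k < K" for k K
  proof (cases "i < k")
    case True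
    then show ?thesis using that unfolding z_def
      by (simp, intro \<xi>_orth[of _ "- int K + int i + 1"] \<xi>_past \<xi>_square) auto
  qed (simp add: z_def)
  have zc: "(\<integral>\<omega>. (z k \<omega>)\<^sup>2 \<partial>P) \<le> (if i < k then (c k)\<^sup>2 else 0)" for k
  proof (cases "i < k")
    case True
    have "ennreal (\<integral>\<omega>. (\<xi> k (- int k + int i + 1) \<omega>)\<^sup>2 \<partial>P) = (\<integral>\<^sup>+\<omega>. ennreal ((\<xi> k (- int k + int i + 1) \<omega>)\<^sup>2) \<partial>P)"
      using \<xi>_square by (intro nn_integral_eq_integral[symmetric]) auto
    also have "\<dots> \<le> ennreal ((c k)\<^sup>2)" by (rule nn_\<xi>')
    finally show ?thesis using True by (simp add: z_def)
  qed (simp add: z_def)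
  have t: "integrable P (\<lambda>\<omega>. (t K \<omega>)\<^sup>2) \<and> (\<integral>\<omega>. (t K \<omega>)\<^sup>2 \<partial>P) \<le> (\<Sum>k<K. if i < k then (c k)\<^sup>2 else 0)" for K
  proof (induction K)
    case (Suc K)
    have eq: "(\<lambda>\<omega>. (t (Suc K) \<omega>)\<^sup>2) = (\<lambda>\<omega>. (t K \<omega>)\<^sup>2 + 2 * (\<Sum>k<K. z K \<omega> * z k \<omega>) + (z K \<omega>)\<^sup>2)"
      by (simp add: t_def power2_eq_square algebra_simps sum_distrib_left)
    have "integrable P (\<lambda>\<omega>. \<Sum>k<K. z K \<omega> * z k \<omega>)" "(\<integral>\<omega>. (\<Sum>k<K. z K \<omega> * z k \<omega>) \<partial>P) = 0"
      using zz orth by auto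
    then show ?case unfolding eq using Suc z2[of K] zc[of K] by simp
  qed (simp add: t_def)
  have nn_t: "(\<integral>\<^sup>+\<omega>. ennreal ((t K \<omega>)\<^sup>2) \<partial>P) \<le> (\<Sum>k. ennreal (if i < k then (c k)\<^sup>2 else 0))" for K
  proof -
    have "(\<integral>\<^sup>+\<omega>. ennreal ((t K \<omega>)\<^sup>2) \<partial>P) = ennreal (\<integral>\<omega>. (t K \<omega>)\<^sup>2 \<partial>P)"
      using t by (intro nn_integral_eq_integral) auto
    also have "\<dots> \<le> ennreal (\<Sum>k<K. if i < k then (c k)\<^sup>2 else 0)" using t by (intro ennreal_leI) auto
    also have "\<dots> = (\<Sum>k<K. ennreal (if i < k then (c k)\<^sup>2 else 0))" by (rule sum_ennreal[symmetric]) auto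
    also have "\<dots> \<le> (\<Sum>k. ennreal (if i < k then (c k)\<^sup>2 else 0))" by (rule sum_le_suminf) auto
    finally show ?thesis .
  qed
  have "AE \<omega> in P. ennreal ((known_part i \<omega>)\<^sup>2) = liminf (\<lambda>K. ennreal ((t K \<omega>)\<^sup>2))"
    using AE_summable_\<xi>[of "\<lambda>k. - int k + int i + 1"]
  proof eventually_elim
    case (elim \<omega>)
    have "summable (\<lambda>k. \<xi> k (- int k + int i + 1) \<omega> - (if k \<in> {..i} then \<xi> k (- int k + int i + 1) \<omega> else 0))"
      by (intro summable_diff elim summable_finite[of "{..i}"]) auto
    also have "(\<lambda>k. \<xi> k (- int k + int i + 1) \<omega> - (if k \<in> {..i} then \<xi> k (- int k + int i + 1) \<omega> else 0)) = (\<lambda>k. z k \<omega>)"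
      by (auto simp: z_def)
    finally have "(\<lambda>K. t K \<omega>) \<longlonglongrightarrow> known_part i \<omega>"
      unfolding t_def known_part_def z_def[symmetric] by (rule summable_LIMSEQ)
    then have "(\<lambda>K. ennreal ((t K \<omega>)\<^sup>2)) \<longlonglongrightarrow> ennreal ((known_part i \<omega>)\<^sup>2)"
      by (intro tendsto_ennrealI tendsto_power)
    then show ?case by (intro lim_imp_Liminf[symmetric]) auto
  qed
  then have "(\<integral>\<^sup>+\<omega>. ennreal ((known_part i \<omega>)\<^sup>2) \<partial>P) = (\<integral>\<^sup>+\<omega>. liminf (\<lambda>K. ennreal ((t K \<omega>)\<^sup>2)) \<partial>P)"
    by (rule nn_integral_cong_AE)
  also have "\<dots> \<le> liminf (\<lambda>K. \<integral>\<^sup>+\<omega>. ennreal ((t K \<omega>)\<^sup>2) \<partial>P)" by (rule nn_integral_liminf) auto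
  also have "\<dots> \<le> liminf (\<lambda>K. (\<Sum>k. ennreal (if i < k then (c k)\<^sup>2 else 0)))"
    by (intro Liminf_mono always_eventually allI nn_t)
  also have "\<dots> = (\<Sum>k. ennreal (if i < k then (c k)\<^sup>2 else 0))" by (simp add: Liminf_const)
  finally show ?thesis .
qed

text \<open>
  Summing the bounds on \<open>known_part i\<close> over \<open>i\<close>, the lag \<open>k\<close> is counted for \<open>i < k\<close>, that is, \<open>k\<close> times.
\<close>
lemma known_part_average_tendsto:
  assumes fin: "(\<Sum>k. ennreal (real k * (b k)\<^sup>2)) < \<top>"
  shows "AE \<omega> in P. (\<lambda>n. (\<Sum>i<n. \<bar>known_part i \<omega>\<bar>)\<^sup>2 / real n) \<longlonglongrightarrow> 0"
proof -
  have "(\<integral>\<^sup>+\<omega>. (\<Sum>i. ennreal ((known_part i \<omega>)\<^sup>2)) \<partial>P) = (\<Sum>i. \<integral>\<^sup>+\<omega>. ennreal ((known_part i \<omega>)\<^sup>2) \<partial>P)"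
    by (rule nn_integral_suminf) auto
  also have "\<dots> \<le> (\<Sum>i. \<Sum>k. ennreal (if i < k then (c k)\<^sup>2 else 0))"
    by (intro suminf_le nn_known_part) auto
  also have "\<dots> = (\<Sum>k. \<Sum>i. ennreal (if i < k then (c k)\<^sup>2 else 0))" by (rule suminf_swap_ennreal)
  also have "\<dots> = (\<Sum>k. ennreal (4 * C\<^sup>2) * ennreal (real k * (b k)\<^sup>2))"
  proof (intro suminf_cong)
    fix k
    have "(\<Sum>i. ennreal (if i < k then (c k)\<^sup>2 else 0)) = (\<Sum>i<k. ennreal (if i < k then (c k)\<^sup>2 else 0))"
      by (rule suminf_finite) auto
    also have "\<dots> = ennreal (real k * (c k)\<^sup>2)"
      by (simp add: ennreal_mult ennreal_of_nat_eq_real_of_nat)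
    also have "real k * (c k)\<^sup>2 = 4 * C\<^sup>2 * (real k * (b k)\<^sup>2)" by (simp add: c_def power_mult_distrib)
    finally show "(\<Sum>i. ennreal (if i < k then (c k)\<^sup>2 else 0)) = ennreal (4 * C\<^sup>2) * ennreal (real k * (b k)\<^sup>2)"
      by (simp add: ennreal_mult)
  qed
  also have "\<dots> < \<infinity>" using fin by (simp add: ennreal_mult_less_top)
  finally have "AE \<omega> in P. (\<Sum>i. ennreal ((known_part i \<omega>)\<^sup>2)) \<noteq> \<infinity>"
    by (intro nn_integral_PInf_AE) auto
  then show ?thesis
    by eventually_elim (auto intro!: square_sum_over_n_tendsto_0 summable_suminf_not_top)
qed

text \<open>
  The known parts are \<open>\<F>\<^sub>0\<close>-measurable and pass through the conditional expectation. The maximal inequality for the future part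
  holds on every event of \<open>\<F>\<^sub>0\<close>, so it holds conditionally with the same constant.
\<close>
lemma quenched_bound:
  "AE \<omega> in P. \<forall>n>0. L20_error M X D n \<omega> \<le> ennreal (2 * ((\<Sum>i<n. \<bar>known_part i \<omega>\<bar>)\<^sup>2 / real n) + 2 * (future_error n)\<^sup>2)"
proof -
  have "AE \<omega> in P. 0 < n \<longrightarrow> L20_error M X D n \<omega> \<le> ennreal (2 * ((\<Sum>i<n. \<bar>known_part i \<omega>\<bar>)\<^sup>2 / real n) + 2 * (future_error n)\<^sup>2)" for n
  proof (cases "0 < n")
    case n: True
    define Q where "Q \<omega> = ennreal (2 * (\<Sum>i<n. \<bar>known_part i \<omega>\<bar>)\<^sup>2)" for \<omega>
    define W where "W \<omega> = 2 * (\<Sum>k. ennreal (future_max k n \<omega>))\<^sup>2" for \<omega>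
    have QF: "Q \<in> borel_measurable (past M 0)"
      unfolding Q_def[abs_def] using known_part_past by measurable
    then have [measurable]: "Q \<in> borel_measurable P" using past_path by auto
    have [measurable]: "W \<in> borel_measurable P" unfolding W_def[abs_def] by measurable
    have 1: "AE \<omega> in P. ennreal (max_sq_error n \<omega>) \<le> Q \<omega> + W \<omega>"
      using mart_error_eq
    proof eventually_elim
      case (elim \<omega>)
      obtain m where m: "m \<le> n" "max_sq_error n \<omega> = (mart_error X D m \<omega>)\<^sup>2" using max_sq_error_attained[OF n] .
      have "\<bar>\<Sum>i<m. known_part i \<omega>\<bar> \<le> (\<Sum>i<m. \<bar>known_part i \<omega>\<bar>)" by (rule sum_abs)
      also have "\<dots> \<le> (\<Sum>i<n. \<bar>known_part i \<omega>\<bar>)" using m by (intro sum_mono2) auto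
      finally have "ennreal \<bar>\<Sum>i<m. known_part i \<omega>\<bar> \<le> ennreal (\<Sum>i<n. \<bar>known_part i \<omega>\<bar>)" by (rule ennreal_leI)
      moreover have "mart_error X D m \<omega> = (\<Sum>i<m. known_part i \<omega>) - (\<Sum>k. mart k m \<omega> - mart k (m - k) \<omega>)" using elim by blast
      ultimately have "ennreal ((mart_error X D m \<omega>)\<^sup>2) \<le> 2 * (ennreal (\<Sum>i<n. \<bar>known_part i \<omega>\<bar>))\<^sup>2 + 2 * (\<Sum>k. ennreal (future_max k n \<omega>))\<^sup>2"
        using future_part_le[OF m(1), of \<omega>] by (intro square_diff_le)
      then show ?case unfolding m(2)
        by (simp add: Q_def W_def ennreal_mult ennreal_power sum_nonneg)
    qed
    have 2: "AE \<omega> in P. nn_cond_exp P (past M 0) W \<omega> \<le> ennreal (2 * real n * (future_error n)\<^sup>2)"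
    proof (rule past.nn_cond_exp_le_const)
      fix A assume A: "A \<in> sets (past M 0)"
      then have [measurable]: "A \<in> sets P" using subalgebra_past[of 0] by (auto simp: subalgebra_def)
      have "(\<integral>\<^sup>+\<omega>. indicator A \<omega> * W \<omega> \<partial>P) = 2 * (\<integral>\<^sup>+\<omega>. indicator A \<omega> * (\<Sum>k. ennreal (future_max k n \<omega>))\<^sup>2 \<partial>P)"
        unfolding W_def by (subst nn_integral_cmult[symmetric]) (auto simp: algebra_simps)
      also have "\<dots> \<le> 2 * ennreal (path.prob A * real n * (future_error n)\<^sup>2)"
        by (intro mult_left_mono nn_future A n) simp
      also have "\<dots> = ennreal (2 * real n * (future_error n)\<^sup>2) * emeasure P A"
        by (simp add: path.emeasure_eq_measure numeral_mult_ennreal algebra_simps flip: ennreal_mult)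
      finally show "(\<integral>\<^sup>+\<omega>. indicator A \<omega> * W \<omega> \<partial>P) \<le> ennreal (2 * real n * (future_error n)\<^sup>2) * emeasure P A" .
    qed auto
    have 3: "AE \<omega> in P. nn_cond_exp P (past M 0) (\<lambda>\<omega>. ennreal (max_sq_error n \<omega>)) \<omega> \<le> nn_cond_exp P (past M 0) (\<lambda>\<omega>. Q \<omega> + W \<omega>) \<omega>"
      using 1 by (rule past.nn_cond_exp_mono) auto
    have 4: "AE \<omega> in P. nn_cond_exp P (past M 0) Q \<omega> + nn_cond_exp P (past M 0) W \<omega> = nn_cond_exp P (past M 0) (\<lambda>\<omega>. Q \<omega> + W \<omega>) \<omega>"
      by (rule past.nn_cond_exp_sum) auto
    show ?thesis using 2 3 4 past.nn_cond_exp_F_meas[OF QF]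
    proof eventually_elim
      case (elim \<omega>)
      have "nn_cond_exp P (past M 0) (\<lambda>\<omega>. ennreal (max_sq_error n \<omega>)) \<omega> \<le> Q \<omega> + ennreal (2 * real n * (future_error n)\<^sup>2)"
        using elim(1,2) unfolding elim(3)[symmetric] elim(4)[symmetric] by (meson add_left_mono order_trans)
      then have "L20_error M X D n \<omega> \<le> ennreal (1 / real n) * (Q \<omega> + ennreal (2 * real n * (future_error n)\<^sup>2))"
        unfolding L20_error_def max_sq_error_def[symmetric] by (rule mult_left_mono) simp
      also have "\<dots> = ennreal (2 * ((\<Sum>i<n. \<bar>known_part i \<omega>\<bar>)\<^sup>2 / real n) + 2 * (future_error n)\<^sup>2)"
        unfolding Q_def using n
        by (subst ennreal_plus[symmetric], simp, simp, subst ennreal_mult[symmetric]) (auto simp: field_simps)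
      finally show ?case by simp
    qed
  qed simp
  then show ?thesis by (simp add: AE_all_countable)
qed

lemma L20_MMA_X:
  assumes fin: "(\<Sum>k. ennreal (real k * (b k)\<^sup>2)) < \<top>"
  shows "L20_MMA M X"
  unfolding L20_MMA_def
proof (intro exI[of _ D] conjI D_mart_diff)
  show "AE \<omega> in P. (\<lambda>n. L20_error M X D n \<omega>) \<longlonglongrightarrow> 0"
    using quenched_bound known_part_average_tendsto[OF fin]
  proof eventually_elim
    case (elim \<omega>)
    show ?case
    proof (rule tendsto_sandwich[OF _ _ tendsto_const])
      show "eventually (\<lambda>n. L20_error M X D n \<omega> \<le> ennreal (2 * ((\<Sum>i<n. \<bar>known_part i \<omega>\<bar>)\<^sup>2 / real n) + 2 * (future_error n)\<^sup>2)) sequentially"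
        using eventually_gt_at_top[of 0] by eventually_elim (use elim(1) in blast)
      have "(\<lambda>n. ennreal (2 * ((\<Sum>i<n. \<bar>known_part i \<omega>\<bar>)\<^sup>2 / real n) + 2 * (future_error n)\<^sup>2)) \<longlonglongrightarrow> ennreal (2 * 0 + 2 * 0\<^sup>2)"
        by (intro tendsto_ennrealI tendsto_add tendsto_mult tendsto_power tendsto_const elim(2) future_error_tendsto)
      then show "(\<lambda>n. ennreal (2 * ((\<Sum>i<n. \<bar>known_part i \<omega>\<bar>)\<^sup>2 / real n) + 2 * (future_error n)\<^sup>2)) \<longlonglongrightarrow> 0" by simp
    qed auto
  qed
  have "(\<integral>\<^sup>+\<omega>. L20_error M X D n \<omega> \<partial>P) = ennreal (1 / real n) * (\<integral>\<^sup>+\<omega>. ennreal (max_sq_error n \<omega>) \<partial>P)" for n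
    using past.nn_cond_exp_intg[of "\<lambda>_. 1" 0 "\<lambda>\<omega>. ennreal (max_sq_error n \<omega>)"]
    unfolding L20_error_def max_sq_error_def[symmetric] by (subst nn_integral_cmult) auto
  then show "(\<lambda>n. \<integral>\<^sup>+\<omega>. L20_error M X D n \<omega> \<partial>P) \<longlonglongrightarrow> 0" using max_sq_error_tendsto by simp
qed

end

theorem proposition5p3:
  fixes M :: "'a measure" and \<gamma> :: real and \<alpha> :: "nat \<Rightarrow> 'a \<Rightarrow> real"
    and f :: "real \<Rightarrow> real"
  defines "X \<equiv> centred_proc M f (lin_proc \<alpha>)"
  assumes "prob_space M"
    and "0 < \<gamma>" and "\<gamma> \<le> 1"
    and "\<And>j. \<alpha> j \<in> borel_measurable M"
    and "(\<Sum>j. L2_enorm M (\<lambda>x. \<bar>\<alpha> j x\<bar> powr \<gamma>)) < \<top>"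
    and "hoelder \<gamma> f"
  shows "(\<exists>D. L2_MMA_with M X D \<and> L2_sums (path_space M) (\<lambda>k. P0 M (X (int k))) D) \<and>
    ((\<Sum>j. of_nat j * (L2_enorm M (\<lambda>x. \<bar>\<alpha> j x\<bar> powr \<gamma>))\<^sup>2) < \<top> \<longrightarrow> L20_MMA M X)"
proof -
  let ?n = "\<lambda>j. L2_enorm M (\<lambda>x. \<bar>\<alpha> j x\<bar> powr \<gamma>)"
  define b where "b j = enn2real (?n j)" for j
  have "?n j \<le> (\<Sum>j. ?n j)" for j
    using sum_le_suminf[of ?n "{j}"] by simp
  then have "?n j < \<top>" for j using assms(6) by (rule le_less_trans)
  then have norm_eq: "?n j = ennreal (b j)" for j by (simp add: b_def)
  have b_nonneg: "0 \<le> b j" for j by (simp add: b_def)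
  obtain C0 where C0: "\<And>x y. \<bar>f x - f y\<bar> \<le> C0 * \<bar>x - y\<bar> powr \<gamma>"
    using assms(7) by (auto simp: hoelder_def)
  have C: "\<bar>f x - f y\<bar> \<le> \<bar>C0\<bar> * \<bar>x - y\<bar> powr \<gamma>" for x y
    using C0[of x y] by (rule order_trans) (simp add: mult_right_mono)
  interpret M: prob_space M by fact
  interpret hoelder_process M \<gamma> "\<bar>C0\<bar>" \<alpha> f b
  proof
    show "0 \<le> b j" for j by (rule b_nonneg)
    then show "summable b" using assms(6) by (intro summable_suminf_not_top) (auto simp: norm_eq)
    show "(\<integral>\<^sup>+x. ennreal ((\<bar>\<alpha> j x\<bar> powr \<gamma>)\<^sup>2) \<partial>M) \<le> ennreal ((b j)\<^sup>2)" for j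
      using L2_enorm_square[of M "\<lambda>x. \<bar>\<alpha> j x\<bar> powr \<gamma>"] by (simp add: norm_eq ennreal_power b_nonneg)
  qed (use assms C in auto)
  have "(\<Sum>j. of_nat j * (?n j)\<^sup>2) = (\<Sum>k. ennreal (real k * (b k)\<^sup>2))"
    by (simp add: norm_eq ennreal_power b_nonneg ennreal_mult ennreal_of_nat_eq_real_of_nat)
  then show ?thesis
    unfolding X_def using D_L2_MMA D_L2_sums L20_MMA_X by auto
qed

end
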